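(* Let $\nu$ be real. The Buschman–Erdélyi operators of zero-order smoothness ${}_1S^\nu_{0+},{}_1P^\nu_{0+},{}_1P^\nu_-,{}_1S^\nu_-$ are unitary in $L_2(0,\infty)$ if and only if $\nu$ is an integer. If this is satisfied, then the operators of the pair $({}_1S^\nu_{0+},{}_1P^\nu_-)$ are mutually inverse and the operators of the pair $({}_1S^\nu_-,{}_1P^\nu_{0+})$ are mutually inverse.
   Context: $P_\nu$ is the Legendre function of the first kind (order $\mu=0$): $P_\nu(z)={}_2F_1(-\nu,\nu+1;1;\frac{1-z}2)$ for $z>-1$. The operators are defined on suitable functions by $${}_1S^\nu_{0+}f(x)=\frac d{dx}\int_0^xP_\nu\Big(\frac xt\Big)f(t)\,dt,\qquad{}_1P^\nu_{0+}f(x)=\int_0^xP_\nu\Big(\frac tx\Big)f'(t)\,dt,$$ $${}_1P^\nu_-f(x)=-\int_x^\infty P_\nu\Big(\frac tx\Big)f'(t)\,dt,\qquad{}_1S^\nu_-f(x)=-\frac d{dx}\int_x^\infty P_\nu\Big(\frac xt\Big)f(t)\,dt.$$ They act as multipliers $M[Af](s)=m_A(s)M[f](s)$ for the Mellin transformation $M[f](s)=\int_0^\infty x^{s-1}f(x)\,dx$, with $$m_{{}_1S^\nu_{0+}}(s)=\frac{\Gamma(-\frac s2+\frac\nu2+1)\Gamma(-\frac s2-\frac\nu2+\frac12)}{\Gamma(\frac12-\frac s2)\Gamma(1-\frac s2)}=\frac1{m_{{}_1P^\nu_{0+}}(s)},\qquad m_{{}_1S^\nu_-}(s)=\frac{\Gamma(\frac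 s2)\Gamma(\frac s2+\frac12)}{\Gamma(\frac s2+\frac\nu2+\frac12)\Gamma(\frac s2-\frac\nu2)}=\frac1{m_{{}_1P^\nu_-}(s)}.$$ In $L_2(0,\infty)$ the operators are understood as Mellin multipliers: multiplication of $M[f](s)$ by $m_A(s)$ (continued analytically) on the line $\operatorname{Re}s=\frac12$. *)

theory Defs
  imports "HOL-Analysis.Analysis"
begin

section \<open>Square-integrable functions and operators between them\<close>

definition L2 :: "'a measure \<Rightarrow> ('a \<Rightarrow> complex) set" where
  "L2 M = {f \<in> borel_measurable M. integrable M (\<lambda>x. (cmod (f x))\<^sup>2)}"

definition L2_eq :: "'a measure \<Rightarrow> ('a \<Rightarrow> complex) \<Rightarrow> ('a \<Rightarrow> complex) \<Rightarrow> bool" where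
  "L2_eq M f g \<longleftrightarrow> f \<in> L2 M \<and> g \<in> L2 M \<and> (AE x in M. f x = g x)"

definition L2_inner :: "'a measure \<Rightarrow> ('a \<Rightarrow> complex) \<Rightarrow> ('a \<Rightarrow> complex) \<Rightarrow> complex" where
  "L2_inner M f g = (LINT x|M. f x * cnj (g x))"

text \<open>
  Elements of the Hilbert space are classes of functions modulo equality almost everywhere,
  and an operator need not be bounded or everywhere defined.  An operator is therefore
  represented by its graph \<open>A\<close>, where \<open>A f g\<close> reads ``the class of \<open>f\<close> is in the domain
  and is mapped to the class of \<open>g\<close>''.
\<close>

definition L2_operator ::
    "'a measure \<Rightarrow> (('a \<Rightarrow> complex) \<Rightarrow> ('a \<Rightarrow> complex) \<Rightarrow> bool) \<Rightarrow> bool" where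
  "L2_operator M A \<longleftrightarrow>
     (\<forall>f g. A f g \<longrightarrow> f \<in> L2 M \<and> g \<in> L2 M) \<and>
     (\<forall>f f' g g'. A f g \<and> L2_eq M f f' \<longrightarrow> (A f' g' \<longleftrightarrow> L2_eq M g g')) \<and>
     (\<forall>a b f f' g g'. A f g \<and> A f' g' \<longrightarrow>
        A (\<lambda>x. a * f x + b * f' x) (\<lambda>x. a * g x + b * g' x))"

definition L2_unitary ::
    "'a measure \<Rightarrow> (('a \<Rightarrow> complex) \<Rightarrow> ('a \<Rightarrow> complex) \<Rightarrow> bool) \<Rightarrow> bool" where
  "L2_unitary M A \<longleftrightarrow>
     L2_operator M A \<and>
     (\<forall>f\<in>L2 M. \<exists>g. A f g) \<and>
     (\<forall>g\<in>L2 M. \<exists>f. A f g) \<and>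
     (\<forall>f f' g g'. A f g \<and> A f' g' \<longrightarrow> L2_inner M g g' = L2_inner M f f')"

text \<open>Both compositions are the identity on the whole space.\<close>

definition L2_mutually_inverse ::
    "'a measure \<Rightarrow> (('a \<Rightarrow> complex) \<Rightarrow> ('a \<Rightarrow> complex) \<Rightarrow> bool)
       \<Rightarrow> (('a \<Rightarrow> complex) \<Rightarrow> ('a \<Rightarrow> complex) \<Rightarrow> bool) \<Rightarrow> bool" where
  "L2_mutually_inverse M A B \<longleftrightarrow>
     L2_operator M A \<and> L2_operator M B \<and> A OO B = L2_eq M \<and> B OO A = L2_eq M"


section \<open>The Mellin transformation\<close>

abbreviation half_line :: "real measure" where
  "half_line \<equiv> restrict_space lborel {0<..}"

definition mellin :: "(real \<Rightarrow> complex) \<Rightarrow> complex \<Rightarrow> complex" where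
  "mellin f s = (LINT x|half_line. of_real x powr (s - 1) * f x)"

text \<open>
  For square-integrable \<open>f\<close> the Mellin integral need not converge absolutely on the line
  \<open>Re s = 1/2\<close>; the transform is then the limit in the mean of the transforms of the
  truncations of \<open>f\<close> to \<open>[1/n, n]\<close> (Plancherel).  Functions on the line are parametrised
  by \<open>t = Im s\<close>.  The mean-square distance is a nonnegative integral, so that a
  non-integrable difference has distance infinity and not the default value 0.
\<close>

definition is_L2_mellin :: "(real \<Rightarrow> complex) \<Rightarrow> (real \<Rightarrow> complex) \<Rightarrow> bool" where
  "is_L2_mellin f F \<longleftrightarrow>
     f \<in> L2 half_line \<and> F \<in> L2 lborel \<and>
     (\<lambda>n. \<integral>\<^sup>+ t. ennreal ((cmod
          (mellin (\<lambda>x. indicator {1 / real n..real n} x *\<^sub>R f x) (Complex (1/2) t) - F t))\<^sup>2)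
        \<partial>lborel) \<longlonglongrightarrow> 0"

text \<open>
  The operator of multiplication by \<open>m\<close> on the Mellin side, on its maximal domain.
\<close>

definition mellin_multiplier ::
    "(complex \<Rightarrow> complex) \<Rightarrow> (real \<Rightarrow> complex) \<Rightarrow> (real \<Rightarrow> complex) \<Rightarrow> bool" where
  "mellin_multiplier m f g \<longleftrightarrow>
     (\<exists>F G. is_L2_mellin f F \<and> is_L2_mellin g G \<and>
        (AE t in lborel. G t = m (Complex (1/2) t) * F t))"


section \<open>Buschman--Erdelyi operators of zero-order smoothness\<close>

text \<open>
  On the line \<open>Re s = 1/2\<close> an argument of one of the Gamma functions below can be a pole
  only at the single point \<open>s = 1/2\<close>, so the totalised values of \<open>Gamma\<close> and of division
  at such a point do not affect the operators.
\<close>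

definition mult_S_0plus :: "real \<Rightarrow> complex \<Rightarrow> complex" where
  "mult_S_0plus \<nu> s =
     (Gamma (- s/2 + of_real \<nu>/2 + 1) * Gamma (- s/2 - of_real \<nu>/2 + 1/2)) /
     (Gamma (1/2 - s/2) * Gamma (1 - s/2))"

definition mult_P_0plus :: "real \<Rightarrow> complex \<Rightarrow> complex" where
  "mult_P_0plus \<nu> s = 1 / mult_S_0plus \<nu> s"

definition mult_S_minus :: "real \<Rightarrow> complex \<Rightarrow> complex" where
  "mult_S_minus \<nu> s =
     (Gamma (s/2) * Gamma (s/2 + 1/2)) /
     (Gamma (s/2 + of_real \<nu>/2 + 1/2) * Gamma (s/2 - of_real \<nu>/2))"

definition mult_P_minus :: "real \<Rightarrow> complex \<Rightarrow> complex" where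
  "mult_P_minus \<nu> s = 1 / mult_S_minus \<nu> s"

definition BE_S_0plus :: "real \<Rightarrow> (real \<Rightarrow> complex) \<Rightarrow> (real \<Rightarrow> complex) \<Rightarrow> bool" where
  "BE_S_0plus \<nu> = mellin_multiplier (mult_S_0plus \<nu>)"

definition BE_P_0plus :: "real \<Rightarrow> (real \<Rightarrow> complex) \<Rightarrow> (real \<Rightarrow> complex) \<Rightarrow> bool" where
  "BE_P_0plus \<nu> = mellin_multiplier (mult_P_0plus \<nu>)"

definition BE_P_minus :: "real \<Rightarrow> (real \<Rightarrow> complex) \<Rightarrow> (real \<Rightarrow> complex) \<Rightarrow> bool" where
  "BE_P_minus \<nu> = mellin_multiplier (mult_P_minus \<nu>)"

definition BE_S_minus :: "real \<Rightarrow> (real \<Rightarrow> complex) \<Rightarrow> (real \<Rightarrow> complex) \<Rightarrow> bool" where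
  "BE_S_minus \<nu> = mellin_multiplier (mult_S_minus \<nu>)"

end

theory Submission
  imports Defs "HOL-Probability.Probability"
begin

text \<open>
  On the critical line \<open>s = 1/2 + it\<close> conjugation is \<open>s \<mapsto> 1 - s\<close>, so Euler's reflection formula gives
  \<open>|m(s)|\<^sup>2 = cosh (\<pi>t) / (cosh (\<pi>t) - sin (\<pi>\<nu>))\<close> for the multiplier \<open>m\<close> of \<open>\<^sub>1S\<^sub>0\<^sub>+\<close>; the others are
  its inverse, its conjugate and the inverse of its conjugate.  The modulus is 1 if \<open>\<nu>\<close> is an integer, and
  otherwise lies strictly on one side of 1 for almost every \<open>t\<close>.  By the Mellin--Plancherel theorem a
  multiplier is unitary in the first case and cannot preserve the norm of any nonzero function
  in the second.

  For Plancherel's theorem, a Gaussian mean and Schur's test bound the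
  Fourier transformation in \<open>L\<^sup>2\<close>, so it extends to \<open>L\<^sup>2\<close> by completeness, and there it satisfies
  \<open>\<integral> \<F>f g = \<integral> f \<F>g\<close>.  Levy's inversion formula for a point mass gives \<open>\<F>\<F>\<chi>(u) = 2\<pi> \<chi>(-u)\<close> for
  indicators \<open>\<chi>\<close> of intervals, and testing against these extends the inversion formula to all of
  \<open>L\<^sup>2\<close>; surjectivity and the norm identity follow.
\<close>


section \<open>Square-integrable functions\<close>

text \<open>The Fourier integral of an integrable function is bounded, but its square is not yet
  known to be integrable, so the norm identity cannot be attacked directly. A Gaussian weight makes
  every integral finite, and its transform is 2 pi times a normal density, a positive kernel of mass
  one; this is why the resulting bound does not depend on the width of the Gaussian. Removing the
  weight by Fatou's lemma leaves only an inequality. That is enough to extend the transformation,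
  and the exact constant 2 pi is recovered from inversion. The substitution x = exp u carries the
  critical line to the Fourier setting: exp (u/2), the square root of the Jacobian, makes it an
  isometry, and the truncations to [1/n, n] become truncations to the symmetric intervals
  [-ln n, ln n]. In the non-integer case the exceptional null set is at most the point t = 0, where
  cosh (pi t) - sin (pi nu) vanishes if sin (pi nu) = 1.\<close>

lemma mem_L2_iff:
  "f \<in> L2 M \<longleftrightarrow> f \<in> borel_measurable M \<and> (\<integral>\<^sup>+x. ennreal ((cmod (f x))\<^sup>2) \<partial>M) < \<infinity>"
  unfolding L2_def by (auto simp: integrable_iff_bounded)

lemma L2_measurable [measurable_dest]: "f \<in> L2 M \<Longrightarrow> f \<in> borel_measurable M"
  by (simp add: L2_def)

lemma L2_cong_AE:
  assumes "f \<in> L2 M" "AE x in M. f x = g x" "g \<in> borel_measurable M"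
  shows "g \<in> L2 M"
proof -
  have "(\<integral>\<^sup>+x. ennreal ((cmod (g x))\<^sup>2) \<partial>M) = (\<integral>\<^sup>+x. ennreal ((cmod (f x))\<^sup>2) \<partial>M)"
    using assms(2) by (intro nn_integral_cong_AE) auto
  thus ?thesis using assms by (simp add: mem_L2_iff)
qed

lemma L2_dominated:
  assumes "f \<in> L2 M" "g \<in> borel_measurable M" "\<And>x. x \<in> space M \<Longrightarrow> cmod (g x) \<le> cmod (f x)"
  shows "g \<in> L2 M"
proof -
  have "(\<integral>\<^sup>+x. ennreal ((cmod (g x))\<^sup>2) \<partial>M) \<le> (\<integral>\<^sup>+x. ennreal ((cmod (f x))\<^sup>2) \<partial>M)"
    using assms(3) by (intro nn_integral_mono ennreal_leI power_mono) auto
  thus ?thesis using assms by (auto simp: mem_L2_iff)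
qed

lemma cmod_add_square_le: "(cmod (a + b))\<^sup>2 \<le> 2 * (cmod a)\<^sup>2 + 2 * (cmod b)\<^sup>2"
proof -
  have "(cmod (a + b))\<^sup>2 \<le> (cmod a + cmod b)\<^sup>2"
    by (intro power_mono norm_triangle_ineq) auto
  also have "\<dots> \<le> 2 * (cmod a)\<^sup>2 + 2 * (cmod b)\<^sup>2"
    using zero_le_power2[of "cmod a - cmod b"] by (simp add: power2_eq_square algebra_simps)
  finally show ?thesis .
qed

lemma nn_integral_square_add_le:
  assumes [measurable]: "f \<in> borel_measurable M" "g \<in> borel_measurable M"
  shows "(\<integral>\<^sup>+x. ennreal ((cmod (f x + g x))\<^sup>2) \<partial>M) \<le>
    2 * (\<integral>\<^sup>+x. ennreal ((cmod (f x))\<^sup>2) \<partial>M) + 2 * (\<integral>\<^sup>+x. ennreal ((cmod (g x))\<^sup>2) \<partial>M)"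
proof -
  have "(\<integral>\<^sup>+x. ennreal ((cmod (f x + g x))\<^sup>2) \<partial>M) \<le>
      (\<integral>\<^sup>+x. 2 * ennreal ((cmod (f x))\<^sup>2) + 2 * ennreal ((cmod (g x))\<^sup>2) \<partial>M)"
  proof (intro nn_integral_mono)
    fix x
    have "ennreal ((cmod (f x + g x))\<^sup>2) \<le> ennreal (2 * (cmod (f x))\<^sup>2 + 2 * (cmod (g x))\<^sup>2)"
      by (intro ennreal_leI cmod_add_square_le)
    thus "ennreal ((cmod (f x + g x))\<^sup>2) \<le> 2 * ennreal ((cmod (f x))\<^sup>2) + 2 * ennreal ((cmod (g x))\<^sup>2)"
      by (simp add: ennreal_plus ennreal_mult)
  qed
  also have "\<dots> = 2 * (\<integral>\<^sup>+x. ennreal ((cmod (f x))\<^sup>2) \<partial>M) + 2 * (\<integral>\<^sup>+x. ennreal ((cmod (g x))\<^sup>2) \<partial>M)"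
    by (simp add: nn_integral_add nn_integral_cmult)
  finally show ?thesis .
qed

lemma L2_add:
  assumes "f \<in> L2 M" "g \<in> L2 M" shows "(\<lambda>x. f x + g x) \<in> L2 M"
  using assms nn_integral_square_add_le[of f M g]
  by (auto simp: mem_L2_iff ennreal_mult_less_top ennreal_add_less_top intro: le_less_trans)

lemma L2_mult_bounded:
  assumes "f \<in> L2 M" and [measurable]: "m \<in> borel_measurable M" and "\<And>x. cmod (m x) \<le> c"
  shows "(\<lambda>x. m x * f x) \<in> L2 M"
proof -
  note [measurable] = L2_measurable[OF assms(1)]
  have "(\<integral>\<^sup>+x. ennreal ((cmod (m x * f x))\<^sup>2) \<partial>M) \<le> (\<integral>\<^sup>+x. ennreal (c\<^sup>2) * ennreal ((cmod (f x))\<^sup>2) \<partial>M)"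
    using assms(3)
    by (intro nn_integral_mono)
       (auto simp: norm_mult power_mult_distrib ennreal_mult[symmetric]
             intro!: ennreal_leI mult_right_mono power_mono)
  also have "\<dots> < \<infinity>"
    using assms(1) by (simp add: nn_integral_cmult mem_L2_iff ennreal_mult_less_top)
  finally show ?thesis by (simp add: mem_L2_iff)
qed

lemma L2_cmult: "f \<in> L2 M \<Longrightarrow> (\<lambda>x. c * f x) \<in> L2 M"
  using L2_mult_bounded[of f M "\<lambda>_. c" "cmod c"] by simp

lemma L2_diff:
  assumes "f \<in> L2 M" "g \<in> L2 M" shows "(\<lambda>x. f x - g x) \<in> L2 M"
  using L2_add[OF assms(1) L2_cmult[OF assms(2), of "-1"]] by simp

lemma borel_measurable_cnj [measurable]: "cnj \<in> borel_measurable borel"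
  by (intro borel_measurable_continuous_onI continuous_intros)

lemma L2_cnj: "f \<in> L2 M \<Longrightarrow> (\<lambda>x. cnj (f x)) \<in> L2 M"
  by (rule L2_dominated[of f]) (auto dest: L2_measurable)

lemma L2_eq_refl: "f \<in> L2 M \<Longrightarrow> L2_eq M f f"
  by (simp add: L2_eq_def)

lemma nn_integral_norm_mult_L2_le:
  assumes [measurable]: "f \<in> borel_measurable M" "g \<in> borel_measurable M"
  shows "(\<integral>\<^sup>+x. ennreal (cmod (f x * g x)) \<partial>M)\<^sup>2 \<le>
    (\<integral>\<^sup>+x. ennreal ((cmod (f x))\<^sup>2) \<partial>M) * (\<integral>\<^sup>+x. ennreal ((cmod (g x))\<^sup>2) \<partial>M)"
  using Cauchy_Schwarz_nn_integral[of "\<lambda>x. ennreal (cmod (f x))" M "\<lambda>x. ennreal (cmod (g x))"]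
  by (simp add: norm_mult ennreal_mult ennreal_power)

lemma L2_integrable_mult:
  assumes "f \<in> L2 M" "g \<in> L2 M"
  shows "integrable M (\<lambda>x. f x * g x)"
proof -
  note [measurable] = assms[THEN L2_measurable]
  have "(\<integral>\<^sup>+x. ennreal (cmod (f x * g x)) \<partial>M)\<^sup>2 < \<infinity>"
    using nn_integral_norm_mult_L2_le[of f M g] assms
    by (auto simp: mem_L2_iff ennreal_mult_less_top intro: le_less_trans)
  hence "(\<integral>\<^sup>+x. ennreal (cmod (f x * g x)) \<partial>M) < \<infinity>"
    by (simp add: power_less_top_ennreal)
  thus ?thesis by (intro integrableI_bounded) auto
qed

lemma L2_inner_self: "L2_inner M f f = of_real (LINT x|M. (cmod (f x))\<^sup>2)"
  unfolding L2_inner_def by (simp flip: complex_norm_square integral_complex_of_real)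

section \<open>Convergence in the mean\<close>

text \<open>The filter is arbitrary because cutoffs tend to infinity both through the reals and
  along sequences such as \<open>ln (real n)\<close>. As a nonnegative integral, the distance is
  infinite, not zero, for a non-integrable difference.\<close>

definition L2_conv :: "'a measure \<Rightarrow> ('i \<Rightarrow> 'a \<Rightarrow> complex) \<Rightarrow> ('a \<Rightarrow> complex) \<Rightarrow> 'i filter \<Rightarrow> bool" where
  "L2_conv M X f net \<longleftrightarrow> ((\<lambda>i. \<integral>\<^sup>+x. ennreal ((cmod (X i x - f x))\<^sup>2) \<partial>M) \<longlongrightarrow> 0) net"

lemma L2_conv_compose:
  "L2_conv M X f F \<Longrightarrow> filterlim r F G \<Longrightarrow> L2_conv M (\<lambda>i. X (r i)) f G"
  unfolding L2_conv_def by (rule filterlim_compose)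

lemma L2_conv_cong:
  assumes "L2_conv M X f net"
    and "\<forall>\<^sub>F i in net. AE x in M. cmod (Y i x - g x) = cmod (X i x - f x)"
  shows "L2_conv M Y g net"
  using assms(1) unfolding L2_conv_def
  by (rule Lim_transform_eventually)
     (use assms(2) in eventually_elim, auto intro!: nn_integral_cong_AE)

lemma L2_conv_cmult:
  assumes "L2_conv M X f net"
    and [measurable]: "\<And>i. X i \<in> borel_measurable M" "f \<in> borel_measurable M"
  shows "L2_conv M (\<lambda>i x. c * X i x) (\<lambda>x. c * f x) net"
proof -
  have "(\<integral>\<^sup>+x. ennreal ((cmod (c * X i x - c * f x))\<^sup>2) \<partial>M) =
      ennreal ((cmod c)\<^sup>2) * (\<integral>\<^sup>+x. ennreal ((cmod (X i x - f x))\<^sup>2) \<partial>M)" for i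
    by (simp add: right_diff_distrib[symmetric] norm_mult power_mult_distrib ennreal_mult
        nn_integral_cmult)
  moreover have "((\<lambda>i. ennreal ((cmod c)\<^sup>2) * (\<integral>\<^sup>+x. ennreal ((cmod (X i x - f x))\<^sup>2) \<partial>M)) \<longlongrightarrow>
      ennreal ((cmod c)\<^sup>2) * 0) net"
    using assms(1) unfolding L2_conv_def by (intro ennreal_tendsto_cmult) auto
  ultimately show ?thesis by (simp add: L2_conv_def)
qed

lemma L2_conv_add:
  assumes "L2_conv M X f net" "L2_conv M Y g net"
    and [measurable]: "\<And>i. X i \<in> borel_measurable M" "f \<in> borel_measurable M"
      "\<And>i. Y i \<in> borel_measurable M" "g \<in> borel_measurable M"
  shows "L2_conv M (\<lambda>i x. X i x + Y i x) (\<lambda>x. f x + g x) net"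
  unfolding L2_conv_def
proof (rule tendsto_sandwich[OF _ _ tendsto_const])
  let ?A = "\<lambda>i. \<integral>\<^sup>+x. ennreal ((cmod (X i x - f x))\<^sup>2) \<partial>M"
  let ?B = "\<lambda>i. \<integral>\<^sup>+x. ennreal ((cmod (Y i x - g x))\<^sup>2) \<partial>M"
  have "((\<lambda>i. 2 * ?A i + 2 * ?B i) \<longlongrightarrow> 2 * 0 + 2 * 0) net"
    using assms(1,2) unfolding L2_conv_def
    by (intro tendsto_add ennreal_tendsto_cmult) auto
  thus "((\<lambda>i. 2 * ?A i + 2 * ?B i) \<longlongrightarrow> 0) net" by simp
  show "\<forall>\<^sub>F i in net. (\<integral>\<^sup>+x. ennreal ((cmod (X i x + Y i x - (f x + g x)))\<^sup>2) \<partial>M) \<le> 2 * ?A i + 2 * ?B i"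
    using nn_integral_square_add_le[of "\<lambda>x. X _ x - f x" M "\<lambda>x. Y _ x - g x"]
    by (auto simp: algebra_simps)
qed auto

lemma L2_conv_unique_AE:
  assumes "L2_conv M X f net" "L2_conv M X g net" "net \<noteq> bot"
    and [measurable]: "\<And>i. X i \<in> borel_measurable M" "f \<in> borel_measurable M" "g \<in> borel_measurable M"
  shows "AE x in M. f x = g x"
proof -
  \<comment> \<open>The approximants cancel, so the distance to the limit no longer depends on
    \<open>i\<close>: it is the distance between \<open>f\<close> and \<open>g\<close>.\<close>
  have "L2_conv M (\<lambda>i x. X i x + - 1 * X i x) (\<lambda>x. f x + - 1 * g x) net"
    by (intro L2_conv_add L2_conv_cmult assms) measurable
  hence "((\<lambda>i. \<integral>\<^sup>+x. ennreal ((cmod (f x - g x))\<^sup>2) \<partial>M) \<longlongrightarrow> 0) net"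
    by (simp add: L2_conv_def norm_minus_commute)
  hence "(\<integral>\<^sup>+x. ennreal ((cmod (f x - g x))\<^sup>2) \<partial>M) = 0"
    using assms(3) by (simp add: tendsto_const_iff)
  thus ?thesis by (simp add: nn_integral_0_iff_AE)
qed

text \<open>Fatou's lemma bounds the distance between the two limits by the lower limit of the mean
  distances, which is zero. No subsequence has to be extracted.\<close>

lemma L2_conv_pointwise_unique:
  fixes X :: "nat \<Rightarrow> 'a \<Rightarrow> complex"
  assumes "L2_conv M X f sequentially" "AE x in M. (\<lambda>i. X i x) \<longlonglongrightarrow> g x"
    and [measurable]: "\<And>i. X i \<in> borel_measurable M" "f \<in> borel_measurable M" "g \<in> borel_measurable M"
  shows "AE x in M. f x = g x"
proof -
  have "(\<integral>\<^sup>+x. ennreal ((cmod (g x - f x))\<^sup>2) \<partial>M)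
      \<le> (\<integral>\<^sup>+x. liminf (\<lambda>i. ennreal ((cmod (X i x - f x))\<^sup>2)) \<partial>M)"
  proof (intro nn_integral_mono_AE, use assms(2) in eventually_elim)
    fix x assume "(\<lambda>i. X i x) \<longlonglongrightarrow> g x"
    hence "(\<lambda>i. ennreal ((cmod (X i x - f x))\<^sup>2)) \<longlonglongrightarrow> ennreal ((cmod (g x - f x))\<^sup>2)"
      by (intro tendsto_intros)
    thus "ennreal ((cmod (g x - f x))\<^sup>2) \<le> liminf (\<lambda>i. ennreal ((cmod (X i x - f x))\<^sup>2))"
      by (metis lim_imp_Liminf order_refl trivial_limit_sequentially)
  qed
  also have "\<dots> \<le> liminf (\<lambda>i. \<integral>\<^sup>+x. ennreal ((cmod (X i x - f x))\<^sup>2) \<partial>M)"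
    by (intro nn_integral_liminf) measurable
  also have "\<dots> = 0"
    using assms(1) by (simp add: L2_conv_def lim_imp_Liminf)
  finally show ?thesis by (auto simp: nn_integral_0_iff_AE)
qed

text \<open>This is Cauchy-Schwarz, kept in squared form so that the estimate stays among
  nonnegative integrals. The pairing has no conjugate because the Fourier transformation is
  symmetric for this bilinear form.\<close>

lemma L2_conv_integral_mult:
  assumes "L2_conv M X f net" "g \<in> L2 M" "f \<in> L2 M" "\<And>i. X i \<in> L2 M"
  shows "((\<lambda>i. LINT x|M. X i x * g x) \<longlongrightarrow> (LINT x|M. f x * g x)) net"
proof -
  note [measurable] = L2_measurable[OF assms(2)] L2_measurable[OF assms(3)] L2_measurable[OF assms(4)]
  define C where "C = (\<integral>\<^sup>+x. ennreal ((cmod (g x))\<^sup>2) \<partial>M)"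
  let ?D = "\<lambda>i. \<integral>\<^sup>+x. ennreal ((cmod (X i x - f x))\<^sup>2) \<partial>M"
  let ?N = "\<lambda>i. cmod ((LINT x|M. X i x * g x) - (LINT x|M. f x * g x))"
  have "C < \<infinity>" using assms(2) by (simp add: C_def mem_L2_iff)
  have le: "ennreal ((?N i)\<^sup>2) \<le> C * ?D i" for i
  proof -
    have int: "integrable M (\<lambda>x. (X i x - f x) * g x)"
      by (intro L2_integrable_mult L2_diff assms)
    have "(LINT x|M. X i x * g x) - (LINT x|M. f x * g x) = (LINT x|M. (X i x - f x) * g x)"
      by (simp add: L2_integrable_mult assms left_diff_distrib)
    hence "ennreal (?N i) \<le> (\<integral>\<^sup>+x. ennreal (cmod ((X i x - f x) * g x)) \<partial>M)"
      using integral_norm_bound_ennreal[OF int] by simp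
    hence "(ennreal (?N i))\<^sup>2 \<le> (\<integral>\<^sup>+x. ennreal (cmod ((X i x - f x) * g x)) \<partial>M)\<^sup>2"
      by (intro power_mono) auto
    also have "\<dots> \<le> ?D i * C"
      unfolding C_def by (rule nn_integral_norm_mult_L2_le) auto
    finally show ?thesis by (simp add: ennreal_power mult.commute)
  qed
  have "((\<lambda>i. C * ?D i) \<longlongrightarrow> C * 0) net"
    using assms(1) \<open>C < \<infinity>\<close> unfolding L2_conv_def by (intro ennreal_tendsto_cmult) auto
  hence "((\<lambda>i. ennreal ((?N i)\<^sup>2)) \<longlongrightarrow> ennreal 0) net"
    by (intro tendsto_sandwich[OF _ always_eventually[OF allI[OF le]] tendsto_const]) auto
  hence "((\<lambda>i. (?N i)\<^sup>2) \<longlongrightarrow> 0) net"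
    by (subst (asm) tendsto_ennreal_iff) auto
  hence "((\<lambda>i. sqrt ((?N i)\<^sup>2)) \<longlongrightarrow> sqrt 0) net"
    by (rule tendsto_real_sqrt)
  thus ?thesis by (simp add: tendsto_norm_zero_iff LIM_zero_iff)
qed

text \<open>
  Along a subsequence with \<open>\<parallel>X\<^sub>j\<^sub>+\<^sub>1 - X\<^sub>j\<parallel>\<^sup>2 \<le> 8\<^sup>-\<^sup>j\<close> the estimate
  \<open>2 |a| \<le> 2\<^sup>-\<^sup>j + 2\<^sup>j |a|\<^sup>2\<close> gives absolute convergence of the telescoping series almost everywhere.
\<close>

theorem L2_complete:
  fixes X :: "nat \<Rightarrow> 'a \<Rightarrow> complex"
  assumes X: "\<And>n. X n \<in> L2 M"
    and Cauchy: "\<And>e. e > 0 \<Longrightarrow> \<exists>N. \<forall>m\<ge>N. \<forall>n\<ge>N. (\<integral>\<^sup>+x. ennreal ((cmod (X m x - X n x))\<^sup>2) \<partial>M) \<le> ennreal e"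
  shows "\<exists>f\<in>L2 M. L2_conv M X f sequentially"
proof -
  note [measurable] = L2_measurable[OF X]
  have "\<forall>k. \<exists>N. \<forall>m\<ge>N. \<forall>n\<ge>N. (\<integral>\<^sup>+x. ennreal ((cmod (X m x - X n x))\<^sup>2) \<partial>M) \<le> ennreal ((1/8)^k)"
    by (intro allI Cauchy) auto
  then obtain N where N: "\<And>k m n. m \<ge> N k \<Longrightarrow> n \<ge> N k \<Longrightarrow>
      (\<integral>\<^sup>+x. ennreal ((cmod (X m x - X n x))\<^sup>2) \<partial>M) \<le> ennreal ((1/8)^k)"
    by metis
  \<comment> \<open>Summing the thresholds puts \<open>r k\<close> and \<open>r (Suc k)\<close> both
    beyond \<open>N k\<close>; the summand \<open>k\<close> forces \<open>r\<close> to tend to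
    infinity.\<close>
  define r where "r k = (\<Sum>j\<le>k. N j) + k" for k
  have r_ge: "N k \<le> r k" "N k \<le> r (Suc k)" for k
  proof -
    have "N k \<le> (\<Sum>j\<le>k. N j)" by (intro member_le_sum) auto
    thus "N k \<le> r k" "N k \<le> r (Suc k)" by (auto simp: r_def)
  qed
  have r_top: "filterlim r at_top sequentially"
    by (rule filterlim_at_top_mono[OF filterlim_ident]) (auto simp: r_def)
  define d where "d k x = X (r (Suc k)) x - X (r k) x" for k x
  have [measurable]: "d k \<in> borel_measurable M" for k unfolding d_def by measurable
  have "(\<integral>\<^sup>+x. (\<Sum>k. ennreal (2^k * (cmod (d k x))\<^sup>2)) \<partial>M)
      = (\<Sum>k. \<integral>\<^sup>+x. ennreal (2^k * (cmod (d k x))\<^sup>2) \<partial>M)"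
    by (intro nn_integral_suminf) measurable
  also have "\<dots> \<le> (\<Sum>k. ennreal ((1/4)^k))"
  proof (intro suminf_le summableI)
    fix k
    have "(\<integral>\<^sup>+x. ennreal (2^k * (cmod (d k x))\<^sup>2) \<partial>M) = ennreal (2^k) * (\<integral>\<^sup>+x. ennreal ((cmod (d k x))\<^sup>2) \<partial>M)"
      by (simp add: ennreal_mult nn_integral_cmult)
    also have "\<dots> \<le> ennreal (2^k) * ennreal ((1/8)^k)"
      unfolding d_def by (intro mult_left_mono N r_ge) auto
    also have "\<dots> = ennreal ((1/4)^k)"
      by (simp add: ennreal_mult[symmetric] power_mult_distrib[symmetric])
    finally show "(\<integral>\<^sup>+x. ennreal (2^k * (cmod (d k x))\<^sup>2) \<partial>M) \<le> ennreal ((1/4)^k)" .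
  qed
  also have "\<dots> < \<infinity>"
    by (subst suminf_ennreal2) (auto intro: summable_geometric)
  finally have "AE x in M. (\<Sum>k. ennreal (2^k * (cmod (d k x))\<^sup>2)) \<noteq> \<infinity>"
    by (intro nn_integral_PInf_AE) auto
  hence conv: "AE x in M. convergent (\<lambda>k. X (r k) x)"
  proof eventually_elim
    fix x assume "(\<Sum>k. ennreal (2^k * (cmod (d k x))\<^sup>2)) \<noteq> \<infinity>"
    hence s: "summable (\<lambda>k. 2^k * (cmod (d k x))\<^sup>2)"
      by (intro summable_suminf_not_top) auto
    have "summable (\<lambda>k. cmod (d k x))"
    proof (rule summable_comparison_test'[of "\<lambda>k. (1/2)^k + 2^k * (cmod (d k x))\<^sup>2" 0])
      show "summable (\<lambda>k. (1/2)^k + 2^k * (cmod (d k x))\<^sup>2)"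
        by (intro summable_add s summable_geometric) auto
      fix k
      have "0 \<le> (1/2)^k * (1 - 2^k * cmod (d k x))\<^sup>2" by simp
      also have "\<dots> = (1/2)^k - 2 * cmod (d k x) + 2^k * (cmod (d k x))\<^sup>2"
        by (simp add: power2_eq_square field_simps)
      finally show "norm (cmod (d k x)) \<le> (1/2)^k + 2^k * (cmod (d k x))\<^sup>2"
        using norm_ge_zero[of "d k x"] unfolding real_norm_def by linarith
    qed
    hence "summable (\<lambda>k. d k x)" by (rule summable_norm_cancel)
    hence "convergent (\<lambda>n. \<Sum>k<n. d k x)" by (simp add: summable_iff_convergent)
    moreover have "(\<Sum>k<n. d k x) = X (r n) x - X (r 0) x" for n
      unfolding d_def by (rule sum_lessThan_telescope)
    ultimately have "convergent (\<lambda>n. X (r 0) x + (X (r n) x - X (r 0) x))"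
      by (intro convergent_add convergent_const) simp
    thus "convergent (\<lambda>k. X (r k) x)" by simp
  qed
  define f where "f x = lim (\<lambda>k. X (r k) x)" for x
  have [measurable]: "f \<in> borel_measurable M" unfolding f_def by measurable
  have lim: "AE x in M. (\<lambda>k. X (r k) x) \<longlonglongrightarrow> f x"
    using conv by eventually_elim (simp add: f_def convergent_LIMSEQ_iff)
  \<comment> \<open>Fatou's lemma along the subsequence carries a Cauchy bound over to the limit. It
    gives convergence of the whole sequence and, with e = 1, the square-integrability of
    \<open>f\<close>.\<close>
  have bound: "(\<integral>\<^sup>+x. ennreal ((cmod (X n x - f x))\<^sup>2) \<partial>M) \<le> ennreal e"
    if "\<forall>m\<ge>K. \<forall>n\<ge>K. (\<integral>\<^sup>+x. ennreal ((cmod (X m x - X n x))\<^sup>2) \<partial>M) \<le> ennreal e" "n \<ge> K" for K n e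
  proof -
    have "(\<integral>\<^sup>+x. ennreal ((cmod (X n x - f x))\<^sup>2) \<partial>M)
        \<le> (\<integral>\<^sup>+x. liminf (\<lambda>k. ennreal ((cmod (X n x - X (r k) x))\<^sup>2)) \<partial>M)"
    proof (intro nn_integral_mono_AE, use lim in eventually_elim)
      fix x assume "(\<lambda>k. X (r k) x) \<longlonglongrightarrow> f x"
      hence "(\<lambda>k. ennreal ((cmod (X n x - X (r k) x))\<^sup>2)) \<longlonglongrightarrow> ennreal ((cmod (X n x - f x))\<^sup>2)"
        by (intro tendsto_intros)
      thus "ennreal ((cmod (X n x - f x))\<^sup>2) \<le> liminf (\<lambda>k. ennreal ((cmod (X n x - X (r k) x))\<^sup>2))"
        by (metis lim_imp_Liminf order_refl trivial_limit_sequentially)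
    qed
    also have "\<dots> \<le> liminf (\<lambda>k. \<integral>\<^sup>+x. ennreal ((cmod (X n x - X (r k) x))\<^sup>2) \<partial>M)"
      by (intro nn_integral_liminf) measurable
    also have "\<dots> \<le> liminf (\<lambda>k. ennreal e)"
    proof (rule Liminf_mono)
      have "\<forall>\<^sub>F k in sequentially. K \<le> r k"
        using r_top by (simp add: filterlim_at_top)
      thus "\<forall>\<^sub>F k in sequentially. (\<integral>\<^sup>+x. ennreal ((cmod (X n x - X (r k) x))\<^sup>2) \<partial>M) \<le> ennreal e"
        by eventually_elim (use that in auto)
    qed
    finally show ?thesis by (simp add: Liminf_const)
  qed
  have "L2_conv M X f sequentially"
    unfolding L2_conv_def
  proof (rule order_tendstoI)
    fix a :: ennreal assume "0 < a"
    then obtain e where e: "0 < e" "ennreal e < a"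
      by (metis dense ennreal_cases ennreal_less_zero_iff less_top_ennreal not_less_zero order_less_trans
          ennreal_0 ennreal_neg linorder_not_less less_irrefl)
    from Cauchy[OF e(1)] obtain K where
      K: "\<forall>m\<ge>K. \<forall>n\<ge>K. (\<integral>\<^sup>+x. ennreal ((cmod (X m x - X n x))\<^sup>2) \<partial>M) \<le> ennreal e" ..
    show "\<forall>\<^sub>F n in sequentially. (\<integral>\<^sup>+x. ennreal ((cmod (X n x - f x))\<^sup>2) \<partial>M) < a"
      using eventually_ge_at_top[of K]
      by eventually_elim (use bound[OF K] e(2) in \<open>auto intro: le_less_trans\<close>)
  qed auto
  moreover have "f \<in> L2 M"
  proof -
    from Cauchy[of 1] obtain K where
      "\<forall>m\<ge>K. \<forall>n\<ge>K. (\<integral>\<^sup>+x. ennreal ((cmod (X m x - X n x))\<^sup>2) \<partial>M) \<le> ennreal 1" by auto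
    from bound[OF this order.refl] have "(\<lambda>x. X K x - f x) \<in> L2 M"
      by (auto simp: mem_L2_iff intro: le_less_trans)
    from L2_diff[OF X[of K] this] show ?thesis by simp
  qed
  ultimately show ?thesis by blast
qed


section \<open>The Fourier transformation of integrable functions\<close>

text \<open>The positive sign agrees with characteristic functions and with the Mellin kernel
  x^(it). Without a normalising factor, 2 pi appears in inversion and in the norm identity.\<close>

definition fourier :: "(real \<Rightarrow> complex) \<Rightarrow> real \<Rightarrow> complex" where
  "fourier f t = (LINT u|lborel. iexp (t * u) * f u)"

lemma measurable_fourier [measurable]:
  assumes [measurable]: "f \<in> borel_measurable borel"
  shows "fourier f \<in> borel_measurable borel"
  unfolding fourier_def by measurable

lemma integrable_iexp_mult:
  "integrable lborel f \<Longrightarrow> integrable lborel (\<lambda>u. iexp (t * u) * f u)"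
  by (rule Bochner_Integration.integrable_bound[of _ f]) (auto simp: norm_mult)

lemma norm_fourier_le:
  assumes "integrable lborel f"
  shows "cmod (fourier f t) \<le> (LINT u|lborel. cmod (f u))"
proof -
  have "cmod (fourier f t) \<le> (LINT u|lborel. cmod (iexp (t * u) * f u))"
    unfolding fourier_def by (rule integral_norm_bound)
  thus ?thesis by (simp add: norm_mult)
qed

lemma integrable_mult_bounded:
  fixes f g :: "'a \<Rightarrow> complex"
  assumes "integrable M f" "g \<in> borel_measurable M" "\<And>x. cmod (g x) \<le> c"
  shows "integrable M (\<lambda>x. g x * f x)"
proof (rule Bochner_Integration.integrable_bound[of _ "\<lambda>x. c * cmod (f x)"])
  show "AE x in M. norm (g x * f x) \<le> norm (c * cmod (f x))"
  proof (intro AE_I2)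
    fix x
    have "c \<ge> 0" using assms(3)[of x] norm_ge_zero[of "g x"] by linarith
    thus "norm (g x * f x) \<le> norm (c * cmod (f x))"
      using assms(3)[of x] by (auto simp: norm_mult abs_mult intro!: mult_right_mono)
  qed
qed (use assms in auto)

text \<open>Fubini: the kernel is symmetric in \<open>t\<close> and \<open>u\<close> and of modulus
  one, so the integrand on the product is dominated by the modulus of f(u) g(t).\<close>

lemma fourier_exchange:
  assumes f: "integrable lborel f" and g: "integrable lborel g"
  shows "(LINT t|lborel. fourier f t * g t) = (LINT u|lborel. f u * fourier g u)"
proof -
  note [measurable] = borel_measurable_integrable[OF f] borel_measurable_integrable[OF g]
  have int: "integrable (lborel \<Otimes>\<^sub>M lborel) (\<lambda>(u, t). iexp (t * u) * f u * g t)"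
  proof (rule lborel_pair.Fubini_integrable)
    have "integrable lborel (\<lambda>u. cmod (f u) * (LINT t|lborel. cmod (g t)))"
      using f by simp
    thus "integrable lborel (\<lambda>u. LINT t|lborel. norm (case (u, t) of (u, t) \<Rightarrow> iexp (t * u) * f u * g t))"
      by (simp add: norm_mult)
    show "AE u in lborel. integrable lborel (\<lambda>t. case (u, t) of (u, t) \<Rightarrow> iexp (t * u) * f u * g t)"
    proof (intro AE_I2)
      fix u show "integrable lborel (\<lambda>t. case (u, t) of (u, t) \<Rightarrow> iexp (t * u) * f u * g t)"
        using integrable_mult_bounded[OF g, of "\<lambda>t. iexp (t * u) * f u" "cmod (f u)"]
        by (simp add: norm_mult)
    qed
  qed measurable
  have "(LINT t|lborel. fourier f t * g t) = (LINT t|lborel. LINT u|lborel. iexp (t * u) * f u * g t)"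
    by (simp add: fourier_def)
  also have "\<dots> = (LINT u|lborel. LINT t|lborel. iexp (t * u) * f u * g t)"
    using lborel_pair.Fubini_integral[OF int] by simp
  also have "\<dots> = (LINT u|lborel. f u * fourier g u)"
  proof (intro Bochner_Integration.integral_cong refl)
    fix u
    have "(LINT t|lborel. iexp (t * u) * f u * g t) = (LINT t|lborel. f u * (iexp (u * t) * g t))"
      by (intro Bochner_Integration.integral_cong refl) (simp add: mult_ac)
    thus "(LINT t|lborel. iexp (t * u) * f u * g t) = f u * fourier g u"
      by (simp add: fourier_def)
  qed
  finally show ?thesis .
qed

section \<open>Symmetries, Gaussians and the mean-square bound for integrable functions\<close>

lemma lborel_integral_reflect:
  fixes f :: "real \<Rightarrow> complex"
  shows "(LINT u|lborel. f (- u)) = (LINT u|lborel. f u)"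
  using lborel_integral_real_affine[of "-1" f 0] by simp

lemma fourier_reflect: "fourier (\<lambda>u. f (- u)) t = fourier f (- t)"
  unfolding fourier_def
  using lborel_integral_reflect[of "\<lambda>u. iexp (- t * u) * f u"] by simp

lemma fourier_cnj: "fourier (\<lambda>u. cnj (f u)) t = cnj (fourier f (- t))"
  unfolding fourier_def
  by (subst Bochner_Integration.integral_cnj[symmetric]) (simp add: exp_cnj)

lemma fourier_normal_density:
  assumes "s > 0"
  shows "fourier (\<lambda>t. of_real (normal_density 0 s t)) w = of_real (exp (- (s * w)\<^sup>2 / 2))"
proof -
  have "fourier (\<lambda>t. of_real (normal_density 0 s t)) w =
      of_real s * (LINT x|lborel. iexp (w * (s * x)) * of_real (normal_density 0 s (s * x)))"
    unfolding fourier_def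
    using lborel_integral_real_affine[of s "\<lambda>t. iexp (w * t) * of_real (normal_density 0 s t)" 0] assms
    by (simp add: scaleR_conv_of_real)
  also have "\<dots> = (LINT x|lborel. of_real s * (iexp (w * (s * x)) * of_real (normal_density 0 s (s * x))))"
    by simp
  also have "\<dots> = (LINT x|lborel. std_normal_density x *\<^sub>R iexp (s * w * x))"
  proof (intro Bochner_Integration.integral_cong refl)
    fix x
    have "s * normal_density 0 s (s * x) = std_normal_density x"
      using assms by (simp add: normal_density_def real_sqrt_mult power_mult_distrib)
    hence "of_real s * of_real (normal_density 0 s (s * x)) = complex_of_real (std_normal_density x)"
      by (metis of_real_mult)
    thus "of_real s * (iexp (w * (s * x)) * of_real (normal_density 0 s (s * x)))
        = std_normal_density x *\<^sub>R iexp (s * w * x)"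
      by (simp add: scaleR_conv_of_real mult_ac)
  qed
  also have "\<dots> = char std_normal_distribution (s * w)"
    unfolding char_def by (subst integral_density) auto
  finally show ?thesis by (simp add: char_std_normal_distribution)
qed

lemma nn_integral_normal_density_shift:
  assumes "s > 0"
  shows "(\<integral>\<^sup>+x. ennreal (normal_density 0 s (c + x)) \<partial>lborel) = 1"
proof -
  have "(\<integral>\<^sup>+x. ennreal (normal_density 0 s (c + x)) \<partial>lborel) = (\<integral>\<^sup>+x. ennreal (normal_density 0 s x) \<partial>lborel)"
    using nn_integral_real_affine[of "\<lambda>x. ennreal (normal_density 0 s x)" 1 c] by simp
  also have "\<dots> = 1"
    using assms by (subst nn_integral_eq_integral) auto
  finally show ?thesis .
qed

text \<open>Schur's test for a normal density as convolution kernel.\<close>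

lemma normal_density_kernel_bound:
  assumes [measurable]: "a \<in> borel_measurable borel" and "s > 0" and "\<And>x::real. a x \<ge> (0::real)"
  shows "(\<integral>\<^sup>+u. \<integral>\<^sup>+v. ennreal (a u * a (- v) * normal_density 0 s (u + v)) \<partial>lborel \<partial>lborel)
    \<le> (\<integral>\<^sup>+u. ennreal ((a u)\<^sup>2) \<partial>lborel)"
proof -
  let ?N = "normal_density 0 s"
  let ?I = "\<integral>\<^sup>+u. ennreal ((a u)\<^sup>2) \<partial>lborel"
  have refl: "(\<integral>\<^sup>+v. ennreal ((a (- v))\<^sup>2) \<partial>lborel) = ?I"
    using nn_integral_real_affine[of "\<lambda>x. ennreal ((a x)\<^sup>2)" "-1" 0] by simp
  have "(\<integral>\<^sup>+u. \<integral>\<^sup>+v. ennreal (a u * a (- v) * ?N (u + v)) \<partial>lborel \<partial>lborel) \<le>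
      (\<integral>\<^sup>+u. \<integral>\<^sup>+v. ennreal (1/2) * (ennreal ((a u)\<^sup>2) * ennreal (?N (u + v)))
        + ennreal (1/2) * (ennreal ((a (- v))\<^sup>2) * ennreal (?N (u + v))) \<partial>lborel \<partial>lborel)"
  proof (intro nn_integral_mono)
    fix u v
    \<comment> \<open>The inequality 2xy <= x^2 + y^2 separates the variables. The kernel has mass
      one in \<open>u\<close> and in \<open>v\<close>, so each half contributes half of the squared
      norm.\<close>
    have "a u * a (- v) \<le> ((a u)\<^sup>2 + (a (- v))\<^sup>2) / 2"
      using zero_le_power2[of "a u - a (- v)"] by (simp add: power2_eq_square algebra_simps)
    hence "a u * a (- v) * ?N (u + v) \<le> ((a u)\<^sup>2 + (a (- v))\<^sup>2) / 2 * ?N (u + v)"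
      by (intro mult_right_mono) auto
    also have "\<dots> = 1/2 * ((a u)\<^sup>2 * ?N (u + v)) + 1/2 * ((a (- v))\<^sup>2 * ?N (u + v))"
      by (simp add: field_simps)
    finally have "ennreal (a u * a (- v) * ?N (u + v))
        \<le> ennreal (1/2 * ((a u)\<^sup>2 * ?N (u + v)) + 1/2 * ((a (- v))\<^sup>2 * ?N (u + v)))"
      by (rule ennreal_leI)
    also have "\<dots> = ennreal (1/2) * (ennreal ((a u)\<^sup>2) * ennreal (?N (u + v)))
        + ennreal (1/2) * (ennreal ((a (- v))\<^sup>2) * ennreal (?N (u + v)))"
      by (subst ennreal_plus) (auto simp only: ennreal_mult' ennreal_mult zero_le_power2
            normal_density_nonneg mult_nonneg_nonneg zero_le_divide_1_iff zero_le_numeral)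
    finally show "ennreal (a u * a (- v) * ?N (u + v))
        \<le> ennreal (1/2) * (ennreal ((a u)\<^sup>2) * ennreal (?N (u + v)))
        + ennreal (1/2) * (ennreal ((a (- v))\<^sup>2) * ennreal (?N (u + v)))" .
  qed
  also have "\<dots> = ennreal (1/2) * (\<integral>\<^sup>+u. ennreal ((a u)\<^sup>2) * (\<integral>\<^sup>+v. ennreal (?N (u + v)) \<partial>lborel) \<partial>lborel)
      + ennreal (1/2) * (\<integral>\<^sup>+u. \<integral>\<^sup>+v. ennreal ((a (- v))\<^sup>2) * ennreal (?N (u + v)) \<partial>lborel \<partial>lborel)"
    by (simp add: nn_integral_add nn_integral_cmult)
  also have "(\<integral>\<^sup>+u. \<integral>\<^sup>+v. ennreal ((a (- v))\<^sup>2) * ennreal (?N (u + v)) \<partial>lborel \<partial>lborel)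
      = (\<integral>\<^sup>+v. \<integral>\<^sup>+u. ennreal ((a (- v))\<^sup>2) * ennreal (?N (u + v)) \<partial>lborel \<partial>lborel)"
    by (rule lborel_pair.Fubini') measurable
  also have "\<dots> = (\<integral>\<^sup>+v. ennreal ((a (- v))\<^sup>2) * (\<integral>\<^sup>+u. ennreal (?N (v + u)) \<partial>lborel) \<partial>lborel)"
    by (simp add: nn_integral_cmult add.commute)
  moreover have "ennreal (1/2) * c + ennreal (1/2) * c = c" for c
    unfolding distrib_right[symmetric] by (subst ennreal_plus[symmetric]) auto
  ultimately show ?thesis
    by (simp only: nn_integral_normal_density_shift[OF assms(2)] refl mult_1_right)
qed

text \<open>The weighted square is a product of \<open>fourier f\<close> with a Gaussian multiple of
  another transform. Exchanging moves the outer transformation onto the second factor, where it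
  becomes convolution with a normal density of deviation 1/s, and Schur's test applies. The bound is
  uniform in \<open>s\<close>.\<close>

lemma fourier_gaussian_mean_le:
  assumes f: "integrable lborel f" and s: "s > 0"
  shows "(\<integral>\<^sup>+t. ennreal (exp (- (t / s)\<^sup>2 / 2) * (cmod (fourier f t))\<^sup>2) \<partial>lborel)
    \<le> ennreal (2 * pi) * (\<integral>\<^sup>+u. ennreal ((cmod (f u))\<^sup>2) \<partial>lborel)"
proof -
  note [measurable] = borel_measurable_integrable[OF f]
  \<comment> \<open>Reflection and conjugation together turn the transform of \<open>f\<close> into
    its conjugate, so the squared modulus becomes the product of the transforms of \<open>f\<close>
    and \<open>k\<close>.\<close>
  define k where "k v = cnj (f (- v))" for v
  have k: "integrable lborel k"
    using lborel_integrable_real_affine[OF f, of "-1" 0] unfolding k_def[abs_def] by simp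
  have fk: "fourier k t = cnj (fourier f t)" for t
    using fourier_cnj[of "\<lambda>u. f (- u)" t] fourier_reflect[of f "- t"] by (simp add: k_def[abs_def])
  define p where "p t = exp (- (t / s)\<^sup>2 / 2)" for t
  have [measurable]: "p \<in> borel_measurable borel" unfolding p_def[abs_def] by measurable
  have p_eq: "p t = sqrt (2 * pi) * s * normal_density 0 s t" for t
    using s by (simp add: p_def normal_density_def power_divide real_sqrt_mult)
  have p: "integrable lborel (\<lambda>t. complex_of_real (p t))"
    using s unfolding p_eq by (intro integrable_of_real integrable_mult_right integrable_normal_density)
  \<comment> \<open>Modulation by \<open>u\<close> shifts the transform of the Gaussian, which is a
    Gaussian of reciprocal width; normalising it produces the factor 2 pi.\<close>
  have p_fou: "fourier (\<lambda>t. iexp (u * t) * of_real (p t)) v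
      = of_real (2 * pi * normal_density 0 (1 / s) (u + v))" for u v
  proof -
    have "fourier (\<lambda>t. iexp (u * t) * of_real (p t)) v = fourier (\<lambda>t. of_real (p t)) (u + v)"
      by (simp add: fourier_def distrib_right distrib_left exp_add mult_ac)
    also have "\<dots> = of_real (sqrt (2 * pi) * s) * fourier (\<lambda>t. of_real (normal_density 0 s t)) (u + v)"
      unfolding p_eq fourier_def integral_mult_right_zero[symmetric]
      by (intro Bochner_Integration.integral_cong refl) (simp add: mult_ac)
    also have "\<dots> = of_real (2 * pi * normal_density 0 (1 / s) (u + v))"
    proof -
      have "sqrt (2 * pi * (1 / s)\<^sup>2) = sqrt (2 * pi) / s"
        using s by (simp add: power_divide real_sqrt_divide)
      moreover have "- (u + v - 0)\<^sup>2 / (2 * (1 / s)\<^sup>2) = - (s * (u + v))\<^sup>2 / 2"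
        by (simp add: power_divide power_mult_distrib)
      ultimately have "normal_density 0 (1 / s) (u + v) = 1 / (sqrt (2 * pi) / s) * exp (- (s * (u + v))\<^sup>2 / 2)"
        by (simp only: normal_density_def)
      moreover have "2 * pi * (1 / (sqrt (2 * pi) / s)) = sqrt (2 * pi) * s"
      proof -
        have "2 * pi * (1 / (sqrt (2 * pi) / s)) = 2 * pi / sqrt (2 * pi) * s" by simp
        thus ?thesis by (simp only: real_div_sqrt pi_ge_zero mult_nonneg_nonneg zero_le_numeral)
      qed
      ultimately have "sqrt (2 * pi) * s * exp (- (s * (u + v))\<^sup>2 / 2) = 2 * pi * normal_density 0 (1 / s) (u + v)"
        by (simp only: mult.assoc[symmetric])
      thus ?thesis by (simp only: fourier_normal_density[OF s] of_real_mult[symmetric])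
    qed
    finally show ?thesis .
  qed
  have kb: "cmod (fourier k t) \<le> (LINT u|lborel. cmod (k u))" for t
    by (rule norm_fourier_le[OF k])
  have pk: "integrable lborel (\<lambda>t. fourier k t * of_real (p t))"
    by (rule integrable_mult_bounded[OF p _ kb]) (use k in measurable)
  have conv: "fourier (\<lambda>t. fourier k t * of_real (p t)) u
      = (LINT v|lborel. k v * of_real (2 * pi * normal_density 0 (1 / s) (u + v)))" for u
  proof -
    have "fourier (\<lambda>t. fourier k t * of_real (p t)) u
        = (LINT t|lborel. fourier k t * (iexp (u * t) * of_real (p t)))"
      unfolding fourier_def[of _ u] by (simp add: mult_ac)
    also have "\<dots> = (LINT v|lborel. k v * fourier (\<lambda>t. iexp (u * t) * of_real (p t)) v)"
      by (intro fourier_exchange k integrable_iexp_mult p)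
    finally show ?thesis by (simp only: p_fou)
  qed
  have int: "integrable lborel (\<lambda>t. fourier f t * (fourier k t * of_real (p t)))"
    by (rule integrable_mult_bounded[OF pk _ norm_fourier_le[OF f]]) measurable
  have eq: "fourier f t * (fourier k t * of_real (p t)) = of_real (p t * (cmod (fourier f t))\<^sup>2)" for t
    by (simp add: fk complex_norm_square mult_ac flip: of_real_power)
  have intr: "integrable lborel (\<lambda>t. p t * (cmod (fourier f t))\<^sup>2)"
    using integrable_Re[OF int] by (simp only: eq Re_complex_of_real)
  have "(\<integral>\<^sup>+t. ennreal (p t * (cmod (fourier f t))\<^sup>2) \<partial>lborel)
      = ennreal (LINT t|lborel. p t * (cmod (fourier f t))\<^sup>2)"
    by (rule nn_integral_eq_integral[OF intr]) (simp add: p_def)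
  \<comment> \<open>The integral is a nonnegative real, so passing to its modulus loses
    nothing.\<close>
  also have "\<dots> = ennreal (cmod (LINT t|lborel. fourier f t * (fourier k t * of_real (p t))))"
    by (simp only: eq integral_complex_of_real norm_of_real) (simp add: p_def)
  also have "(LINT t|lborel. fourier f t * (fourier k t * of_real (p t)))
      = (LINT u|lborel. f u * fourier (\<lambda>t. fourier k t * of_real (p t)) u)"
    by (rule fourier_exchange[OF f pk])
  also have "ennreal (cmod \<dots>) \<le> (\<integral>\<^sup>+u. ennreal (cmod (f u * fourier (\<lambda>t. fourier k t * of_real (p t)) u)) \<partial>lborel)"
    by (rule integral_norm_bound_ennreal, subst mult.commute)
       (rule integrable_mult_bounded[OF f _ norm_fourier_le[OF pk]], use k p_eq in measurable)
  also have "\<dots> \<le> (\<integral>\<^sup>+u. \<integral>\<^sup>+v. ennreal (2 * pi) *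
      ennreal (cmod (f u) * cmod (f (- v)) * normal_density 0 (1 / s) (u + v)) \<partial>lborel \<partial>lborel)"
  proof (intro nn_integral_mono)
    fix u
    let ?G = "\<lambda>v. k v * of_real (2 * pi * normal_density 0 (1 / s) (u + v))"
    have "integrable lborel (\<lambda>v. fourier (\<lambda>t. iexp (u * t) * of_real (p t)) v * k v)"
      by (rule integrable_mult_bounded[OF k _ norm_fourier_le[OF integrable_iexp_mult[OF p]]])
         (simp only: p_fou, measurable)
    hence "integrable lborel ?G" unfolding p_fou by (simp only: mult.commute)
    from integral_norm_bound_ennreal[OF this]
    have "ennreal (cmod (fourier (\<lambda>t. fourier k t * of_real (p t)) u)) \<le> (\<integral>\<^sup>+v. ennreal (cmod (?G v)) \<partial>lborel)"
      by (simp only: conv)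
    hence "ennreal (cmod (f u * fourier (\<lambda>t. fourier k t * of_real (p t)) u))
        \<le> ennreal (cmod (f u)) * (\<integral>\<^sup>+v. ennreal (cmod (?G v)) \<partial>lborel)"
      by (simp add: norm_mult ennreal_mult mult_left_mono)
    also have "\<dots> = (\<integral>\<^sup>+v. ennreal (cmod (f u)) * ennreal (cmod (?G v)) \<partial>lborel)"
      by (rule nn_integral_cmult[symmetric]) (use k in measurable)
    also have "\<dots> = (\<integral>\<^sup>+v. ennreal (2 * pi) *
        ennreal (cmod (f u) * cmod (f (- v)) * normal_density 0 (1 / s) (u + v)) \<partial>lborel)"
      by (intro nn_integral_cong)
         (simp add: ennreal_mult[symmetric] norm_mult k_def mult_ac)
    finally show "ennreal (cmod (f u * fourier (\<lambda>t. fourier k t * of_real (p t)) u)) \<le>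
        (\<integral>\<^sup>+v. ennreal (2 * pi) *
        ennreal (cmod (f u) * cmod (f (- v)) * normal_density 0 (1 / s) (u + v)) \<partial>lborel)" .
  qed
  also have "\<dots> = ennreal (2 * pi) * (\<integral>\<^sup>+u. \<integral>\<^sup>+v.
      ennreal (cmod (f u) * cmod (f (- v)) * normal_density 0 (1 / s) (u + v)) \<partial>lborel \<partial>lborel)"
    by (simp add: nn_integral_cmult)
  also have "\<dots> \<le> ennreal (2 * pi) * (\<integral>\<^sup>+u. ennreal ((cmod (f u))\<^sup>2) \<partial>lborel)"
    using s by (intro mult_left_mono normal_density_kernel_bound) auto
  finally show ?thesis by (simp add: p_def)
qed

text \<open>As the width n + 1 of the Gaussian grows, the weight tends to one at each point, and
  Fatou's lemma keeps the uniform bound.\<close>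

lemma fourier_nn_integral_square_le:
  assumes f: "integrable lborel f"
  shows "(\<integral>\<^sup>+t. ennreal ((cmod (fourier f t))\<^sup>2) \<partial>lborel)
    \<le> ennreal (2 * pi) * (\<integral>\<^sup>+u. ennreal ((cmod (f u))\<^sup>2) \<partial>lborel)"
proof -
  note [measurable] = borel_measurable_integrable[OF f]
  let ?w = "\<lambda>n t. exp (- (t / real (Suc n))\<^sup>2 / 2)"
  have "(\<integral>\<^sup>+t. ennreal ((cmod (fourier f t))\<^sup>2) \<partial>lborel)
      = (\<integral>\<^sup>+t. liminf (\<lambda>n. ennreal (?w n t * (cmod (fourier f t))\<^sup>2)) \<partial>lborel)"
  proof (intro nn_integral_cong)
    fix t :: real
    have "(\<lambda>n. t / real (Suc n)) \<longlonglongrightarrow> 0"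
      by (rule LIMSEQ_Suc) (rule lim_const_over_n)
    hence "(\<lambda>n. ennreal (?w n t * (cmod (fourier f t))\<^sup>2))
        \<longlonglongrightarrow> ennreal (exp (- 0\<^sup>2 / 2) * (cmod (fourier f t))\<^sup>2)"
      by (intro tendsto_intros) auto
    from lim_imp_Liminf[OF trivial_limit_sequentially this]
    show "ennreal ((cmod (fourier f t))\<^sup>2) = liminf (\<lambda>n. ennreal (?w n t * (cmod (fourier f t))\<^sup>2))"
      by simp
  qed
  also have "\<dots> \<le> liminf (\<lambda>n. \<integral>\<^sup>+t. ennreal (?w n t * (cmod (fourier f t))\<^sup>2) \<partial>lborel)"
    by (intro nn_integral_liminf) measurable
  also have "\<dots> \<le> liminf (\<lambda>n::nat. ennreal (2 * pi) * (\<integral>\<^sup>+u. ennreal ((cmod (f u))\<^sup>2) \<partial>lborel))"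
    by (intro Liminf_mono always_eventually allI fourier_gaussian_mean_le f) simp
  finally show ?thesis by (simp add: Liminf_const)
qed


section \<open>The Fourier--Plancherel transformation\<close>

text \<open>Truncation makes a square-integrable function integrable. The symmetric interval
  commutes with reflection and is the logarithmic image of [1/n, n] for R = ln n.\<close>

definition trunc :: "real \<Rightarrow> (real \<Rightarrow> complex) \<Rightarrow> real \<Rightarrow> complex" where
  "trunc R f u = indicator {-R..R} u *\<^sub>R f u"

lemma measurable_trunc [measurable]:
  assumes [measurable]: "f \<in> borel_measurable borel"
  shows "trunc R f \<in> borel_measurable borel"
  unfolding trunc_def[abs_def] by measurable

lemma L2_lborel_measurable: "f \<in> L2 lborel \<Longrightarrow> f \<in> borel_measurable borel"
  using L2_measurable[of f lborel] by simp

lemma L2_trunc: "f \<in> L2 lborel \<Longrightarrow> trunc R f \<in> L2 lborel"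
  by (rule L2_dominated[of f])
     (auto simp: trunc_def indicator_def intro!: measurable_trunc dest: L2_lborel_measurable)

lemma L2_indicator: "(indicator {a..b} :: real \<Rightarrow> complex) \<in> L2 lborel"
proof -
  have "(\<integral>\<^sup>+x. ennreal ((cmod (indicator {a..b} x))\<^sup>2) \<partial>lborel) = (\<integral>\<^sup>+x. indicator {a..b} x \<partial>lborel)"
    by (intro nn_integral_cong) (auto simp: indicator_def)
  thus ?thesis by (simp add: mem_L2_iff emeasure_lborel_Icc_eq)
qed

lemma integrable_trunc:
  assumes "f \<in> L2 lborel" shows "integrable lborel (trunc R f)"
proof -
  have "trunc R f = (\<lambda>u. indicator {-R..R} u * f u)"
    by (auto simp: trunc_def indicator_def)
  thus ?thesis using L2_integrable_mult[OF L2_indicator assms] by simp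
qed

lemma L2_fourier:
  assumes "integrable lborel f" "f \<in> L2 lborel" shows "fourier f \<in> L2 lborel"
proof -
  have "ennreal (2 * pi) * (\<integral>\<^sup>+u. ennreal ((cmod (f u))\<^sup>2) \<partial>lborel) < \<infinity>"
    using assms(2) by (simp add: mem_L2_iff ennreal_mult_less_top)
  thus ?thesis
    using fourier_nn_integral_square_le[OF assms(1)] measurable_fourier[OF L2_lborel_measurable[OF assms(2)]]
    by (auto simp: mem_L2_iff intro: le_less_trans)
qed

text \<open>Dominated convergence with majorant |f|^2, applied along every sequence of cutoffs
  tending to infinity.\<close>

lemma L2_conv_trunc:
  assumes "f \<in> L2 lborel" shows "L2_conv lborel (\<lambda>R. trunc R f) f at_top"
  unfolding L2_conv_def
proof (rule tendsto_at_topI_sequentially)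
  fix r :: "nat \<Rightarrow> real" assume r: "filterlim r at_top sequentially"
  note [measurable] = L2_lborel_measurable[OF assms]
  have "(\<lambda>n. \<integral>\<^sup>+x. ennreal ((cmod (trunc (r n) f x - f x))\<^sup>2) \<partial>lborel) \<longlonglongrightarrow> (\<integral>\<^sup>+x. 0 \<partial>(lborel :: real measure))"
  proof (rule nn_integral_dominated_convergence[where w = "\<lambda>x. ennreal ((cmod (f x))\<^sup>2)"])
    show "AE x in lborel. (\<lambda>n. ennreal ((cmod (trunc (r n) f x - f x))\<^sup>2)) \<longlonglongrightarrow> 0"
    proof (intro AE_I2)
      fix x :: real
      have "\<forall>\<^sub>F n in sequentially. \<bar>x\<bar> \<le> r n" using r by (simp add: filterlim_at_top)
      hence "\<forall>\<^sub>F n in sequentially. ennreal ((cmod (trunc (r n) f x - f x))\<^sup>2) = 0"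
        by eventually_elim (auto simp: trunc_def indicator_def abs_le_iff)
      thus "(\<lambda>n. ennreal ((cmod (trunc (r n) f x - f x))\<^sup>2)) \<longlonglongrightarrow> 0"
        by (rule tendsto_eventually)
    qed
  qed (use assms in \<open>auto simp: mem_L2_iff trunc_def indicator_def\<close>)
  thus "(\<lambda>n. \<integral>\<^sup>+x. ennreal ((cmod (trunc (r n) f x - f x))\<^sup>2) \<partial>lborel) \<longlonglongrightarrow> 0" by simp
qed

text \<open>A relation, since a limit in the mean is determined only almost everywhere. The cutoffs
  run through all reals, so that limits along any sequence of cutoffs can be read off.\<close>

definition is_fourier :: "(real \<Rightarrow> complex) \<Rightarrow> (real \<Rightarrow> complex) \<Rightarrow> bool" where
  "is_fourier f F \<longleftrightarrow> f \<in> L2 lborel \<and> F \<in> L2 lborel \<and>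
     L2_conv lborel (\<lambda>R. fourier (trunc R f)) F at_top"

lemma is_fourier_L2: "is_fourier f F \<Longrightarrow> f \<in> L2 lborel" "is_fourier f F \<Longrightarrow> F \<in> L2 lborel"
  by (auto simp: is_fourier_def)

lemma fourier_diff:
  assumes "integrable lborel f" "integrable lborel g"
  shows "fourier (\<lambda>u. f u - g u) t = fourier f t - fourier g t"
  unfolding fourier_def using assms[THEN integrable_iexp_mult, of t] by (simp add: right_diff_distrib)

text \<open>Inserting \<open>f\<close> between the two truncations leaves the two tails, each of
  which tends to zero. This is the Cauchy estimate for the transforms.\<close>

lemma fourier_trunc_dist_le:
  assumes f: "f \<in> L2 lborel"
  defines "D \<equiv> \<lambda>R. \<integral>\<^sup>+x. ennreal ((cmod (trunc R f x - f x))\<^sup>2) \<partial>lborel"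
  shows "(\<integral>\<^sup>+t. ennreal ((cmod (fourier (trunc R f) t - fourier (trunc S f) t))\<^sup>2) \<partial>lborel)
    \<le> ennreal (2 * pi) * (2 * D R + 2 * D S)"
proof -
  note [measurable] = L2_lborel_measurable[OF f]
  have "(\<integral>\<^sup>+t. ennreal ((cmod (fourier (trunc R f) t - fourier (trunc S f) t))\<^sup>2) \<partial>lborel)
      = (\<integral>\<^sup>+t. ennreal ((cmod (fourier (\<lambda>u. trunc R f u - trunc S f u) t))\<^sup>2) \<partial>lborel)"
    by (simp add: fourier_diff integrable_trunc f)
  also have "\<dots> \<le> ennreal (2 * pi) * (\<integral>\<^sup>+u. ennreal ((cmod (trunc R f u - trunc S f u))\<^sup>2) \<partial>lborel)"
    by (intro fourier_nn_integral_square_le Bochner_Integration.integrable_diff integrable_trunc f)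
  also have "(\<integral>\<^sup>+u. ennreal ((cmod (trunc R f u - trunc S f u))\<^sup>2) \<partial>lborel) \<le> 2 * D R + 2 * D S"
    using nn_integral_square_add_le[of "\<lambda>u. trunc R f u - f u" lborel "\<lambda>u. f u - trunc S f u"]
    by (simp add: D_def norm_minus_commute)
  finally show ?thesis by (simp add: mult_left_mono)
qed

theorem is_fourier_exists:
  assumes f: "f \<in> L2 lborel" shows "\<exists>F. is_fourier f F"
proof -
  note [measurable] = L2_lborel_measurable[OF f]
  define D where "D R = (\<integral>\<^sup>+x. ennreal ((cmod (trunc R f x - f x))\<^sup>2) \<partial>lborel)" for R
  have D: "(D \<longlongrightarrow> 0) at_top"
    using L2_conv_trunc[OF f] by (simp add: L2_conv_def D_def[abs_def])
  let ?X = "\<lambda>R. fourier (trunc R f)"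
  have X: "?X R \<in> L2 lborel" for R by (intro L2_fourier integrable_trunc L2_trunc f)
  have dist: "(\<integral>\<^sup>+t. ennreal ((cmod (?X R t - ?X S t))\<^sup>2) \<partial>lborel) \<le> ennreal (2 * pi) * (2 * D R + 2 * D S)" for R S
    using fourier_trunc_dist_le[OF f] by (simp add: D_def)
  have "\<exists>F\<in>L2 lborel. L2_conv lborel (\<lambda>n. ?X (real n)) F sequentially"
  proof (rule L2_complete)
    fix e :: real assume "e > 0"
    have "((\<lambda>R. ennreal (2 * pi) * (4 * D R)) \<longlongrightarrow> ennreal (2 * pi) * (4 * 0)) at_top"
      by (intro ennreal_tendsto_cmult D) auto
    hence "\<forall>\<^sub>F R in at_top. ennreal (2 * pi) * (4 * D R) < ennreal e"
      by (rule order_tendstoD) (simp add: \<open>e > 0\<close>)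
    then obtain N where N: "\<And>R. R \<ge> N \<Longrightarrow> ennreal (2 * pi) * (4 * D R) < ennreal e"
      by (auto simp: eventually_at_top_linorder)
    have "(\<integral>\<^sup>+t. ennreal ((cmod (?X (real m) t - ?X (real n) t))\<^sup>2) \<partial>lborel) \<le> ennreal e"
      if "m \<ge> nat \<lceil>N\<rceil>" "n \<ge> nat \<lceil>N\<rceil>" for m n
    proof -
      have "real m \<ge> N" "real n \<ge> N" using that by linarith+
      have "ennreal (2 * pi) * (2 * D (real m) + 2 * D (real n))
          \<le> ennreal (2 * pi) * (4 * max (D (real m)) (D (real n)))"
      proof (intro mult_left_mono)
        have "2 * D (real m) + 2 * D (real n)
            \<le> 2 * max (D (real m)) (D (real n)) + 2 * max (D (real m)) (D (real n))"
          by (intro add_mono mult_left_mono) auto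
        thus "2 * D (real m) + 2 * D (real n) \<le> 4 * max (D (real m)) (D (real n))"
          by (simp add: distrib_right[symmetric])
      qed auto
      also have "\<dots> \<le> ennreal e"
        using N[OF \<open>real m \<ge> N\<close>] N[OF \<open>real n \<ge> N\<close>] by (auto simp: max_def less_imp_le)
      finally show ?thesis using dist[of "real m" "real n"] by (rule order.trans[rotated])
    qed
    thus "\<exists>K. \<forall>m\<ge>K. \<forall>n\<ge>K. (\<integral>\<^sup>+t. ennreal ((cmod (?X (real m) t - ?X (real n) t))\<^sup>2) \<partial>lborel) \<le> ennreal e"
      by blast
  qed (rule X)
  then obtain F where F: "F \<in> L2 lborel" "L2_conv lborel (\<lambda>n. ?X (real n)) F sequentially" by auto
  note [measurable] = L2_lborel_measurable[OF F(1)]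
  \<comment> \<open>Completeness provides a limit along integer cutoffs only. A real cutoff R is
    compared with its integer part, and the same tail estimate controls the difference.\<close>
  have r: "filterlim (\<lambda>R. real (nat \<lfloor>R\<rfloor>)) at_top at_top"
    by (intro filterlim_compose[OF filterlim_real_sequentially]
        filterlim_compose[OF filterlim_nat_sequentially filterlim_floor_sequentially])
  have "L2_conv lborel ?X F at_top"
    unfolding L2_conv_def
  proof (rule tendsto_sandwich[OF _ _ tendsto_const])
    let ?E = "\<lambda>n. \<integral>\<^sup>+t. ennreal ((cmod (?X (real n) t - F t))\<^sup>2) \<partial>lborel"
    let ?U = "\<lambda>R. 2 * (ennreal (2 * pi) * (2 * D R + 2 * D (real (nat \<lfloor>R\<rfloor>)))) + 2 * ?E (nat \<lfloor>R\<rfloor>)"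
    show "\<forall>\<^sub>F R in at_top. (\<integral>\<^sup>+t. ennreal ((cmod (?X R t - F t))\<^sup>2) \<partial>lborel) \<le> ?U R"
    proof (intro always_eventually allI)
      fix R
      have "(\<integral>\<^sup>+t. ennreal ((cmod (?X R t - F t))\<^sup>2) \<partial>lborel) \<le>
          2 * (\<integral>\<^sup>+t. ennreal ((cmod (?X R t - ?X (real (nat \<lfloor>R\<rfloor>)) t))\<^sup>2) \<partial>lborel) + 2 * ?E (nat \<lfloor>R\<rfloor>)"
        using nn_integral_square_add_le[of "\<lambda>t. ?X R t - ?X (real (nat \<lfloor>R\<rfloor>)) t" lborel
            "\<lambda>t. ?X (real (nat \<lfloor>R\<rfloor>)) t - F t"] by simp
      also have "\<dots> \<le> ?U R"
        by (intro add_mono mult_left_mono dist) auto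
      finally show "(\<integral>\<^sup>+t. ennreal ((cmod (?X R t - F t))\<^sup>2) \<partial>lborel) \<le> ?U R" .
    qed
    have "(?U \<longlongrightarrow> 2 * (ennreal (2 * pi) * (2 * 0 + 2 * 0)) + 2 * 0) at_top"
      using F(2) unfolding L2_conv_def
      by (intro tendsto_add ennreal_tendsto_cmult D filterlim_compose[OF D r]
            filterlim_compose[of ?E, OF _ filterlim_compose[OF filterlim_nat_sequentially filterlim_floor_sequentially]])
         auto
    thus "(?U \<longlongrightarrow> 0) at_top" by simp
  qed auto
  thus ?thesis using F(1) f by (auto simp: is_fourier_def)
qed

section \<open>Uniqueness, linearity and symmetries of the extended transformation\<close>

lemma fourier_cong_AE:
  assumes "AE u in lborel. f u = g u" "f \<in> borel_measurable borel" "g \<in> borel_measurable borel"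
  shows "fourier f t = fourier g t"
  unfolding fourier_def
  by (rule integral_cong_AE) (use assms in auto)

lemma is_fourier_cong:
  assumes "is_fourier f F" "AE u in lborel. f u = g u" "AE t in lborel. F t = G t"
    and [measurable]: "g \<in> borel_measurable borel" "G \<in> borel_measurable borel"
  shows "is_fourier g G"
proof -
  note fF = is_fourier_L2[OF assms(1)]
  note [measurable] = fF[THEN L2_lborel_measurable]
  have "fourier (trunc R g) = fourier (trunc R f)" for R
    by (intro ext fourier_cong_AE) (use assms(2) in \<open>auto simp: trunc_def\<close>)
  moreover have "L2_conv lborel (\<lambda>R. fourier (trunc R f)) G at_top"
  proof (rule L2_conv_cong)
    show "L2_conv lborel (\<lambda>R. fourier (trunc R f)) F at_top"
      using assms(1) by (simp add: is_fourier_def)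
    show "\<forall>\<^sub>F R in at_top. AE t in lborel.
        cmod (fourier (trunc R f) t - G t) = cmod (fourier (trunc R f) t - F t)"
      by (rule always_eventually, rule allI) (use assms(3) in eventually_elim, simp)
  qed
  ultimately show ?thesis
    using L2_cong_AE[OF fF(1) assms(2)] L2_cong_AE[OF fF(2) assms(3)]
    by (simp add: is_fourier_def)
qed

lemma is_fourier_unique:
  assumes "is_fourier f F" "is_fourier f G"
  shows "AE t in lborel. F t = G t"
proof -
  note [measurable] = assms[THEN is_fourier_L2(1), THEN L2_lborel_measurable]
    assms[THEN is_fourier_L2(2), THEN L2_lborel_measurable]
  show ?thesis
    by (rule L2_conv_unique_AE[of lborel "\<lambda>R. fourier (trunc R f)" _ at_top])
       (use assms in \<open>auto simp: is_fourier_def\<close>)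
qed

lemma is_fourier_cmult:
  assumes "is_fourier f F" shows "is_fourier (\<lambda>u. c * f u) (\<lambda>t. c * F t)"
proof -
  note [measurable] = assms[THEN is_fourier_L2(1), THEN L2_lborel_measurable]
    assms[THEN is_fourier_L2(2), THEN L2_lborel_measurable]
  have "L2_conv lborel (\<lambda>R t. c * fourier (trunc R f) t) (\<lambda>t. c * F t) at_top"
    using assms by (intro L2_conv_cmult) (auto simp: is_fourier_def)
  moreover have "fourier (trunc R (\<lambda>u. c * f u)) = (\<lambda>t. c * fourier (trunc R f) t)" for R
    unfolding fourier_def integral_mult_right_zero[symmetric] by (simp add: trunc_def mult_ac)
  ultimately show ?thesis using assms by (simp add: is_fourier_def L2_cmult)
qed

lemma fourier_add:
  assumes "integrable lborel f" "integrable lborel g"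
  shows "fourier (\<lambda>u. f u + g u) t = fourier f t + fourier g t"
  unfolding fourier_def using assms[THEN integrable_iexp_mult, of t] by (simp add: distrib_left)

lemma is_fourier_add:
  assumes f: "is_fourier f F" and g: "is_fourier g G"
  shows "is_fourier (\<lambda>u. f u + g u) (\<lambda>t. F t + G t)"
proof -
  note L2 = is_fourier_L2[OF f] is_fourier_L2[OF g]
  note [measurable] = L2[THEN L2_lborel_measurable]
  have "L2_conv lborel (\<lambda>R t. fourier (trunc R f) t + fourier (trunc R g) t) (\<lambda>t. F t + G t) at_top"
    using f g by (intro L2_conv_add) (auto simp: is_fourier_def)
  moreover have "fourier (trunc R (\<lambda>u. f u + g u)) = (\<lambda>t. fourier (trunc R f) t + fourier (trunc R g) t)" for R
    using fourier_add[OF integrable_trunc[OF L2(1)] integrable_trunc[OF L2(3)], of R R]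
    by (simp add: trunc_def[abs_def] scaleR_add_right fun_eq_iff)
  ultimately show ?thesis by (simp add: is_fourier_def L2_add L2)
qed

lemma L2_reflect:
  fixes f :: "real \<Rightarrow> complex"
  assumes "f \<in> L2 lborel" shows "(\<lambda>x. f (- x)) \<in> L2 lborel"
proof -
  note [measurable] = L2_lborel_measurable[OF assms]
  show ?thesis
    using assms nn_integral_real_affine[of "\<lambda>x. ennreal ((cmod (f x))\<^sup>2)" "-1" 0]
    by (simp add: mem_L2_iff)
qed

lemma trunc_reflect: "trunc R (\<lambda>u. f (- u)) = (\<lambda>u. trunc R f (- u))"
  by (intro ext) (auto simp: trunc_def indicator_def)

lemma is_fourier_reflect:
  assumes "is_fourier f F" shows "is_fourier (\<lambda>u. f (- u)) (\<lambda>t. F (- t))"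
proof -
  note [measurable] = assms[THEN is_fourier_L2(1), THEN L2_lborel_measurable]
    assms[THEN is_fourier_L2(2), THEN L2_lborel_measurable]
  have "(\<integral>\<^sup>+t. ennreal ((cmod (fourier (trunc R (\<lambda>u. f (- u))) t - F (- t)))\<^sup>2) \<partial>lborel)
      = (\<integral>\<^sup>+t. ennreal ((cmod (fourier (trunc R f) t - F t))\<^sup>2) \<partial>lborel)" for R
    using nn_integral_real_affine[of "\<lambda>t. ennreal ((cmod (fourier (trunc R f) t - F t))\<^sup>2)" "-1" 0]
    by (simp add: trunc_reflect fourier_reflect)
  thus ?thesis using assms by (simp add: is_fourier_def L2_conv_def L2_reflect)
qed

text \<open>Conjugation reflects the frequency and reflection undoes this. The lemma exhibits the
  conjugate of a transform as a transform, which the proof of the norm identity needs.\<close>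

lemma is_fourier_cnj_reflect:
  assumes "is_fourier f F" shows "is_fourier (\<lambda>u. cnj (f (- u))) (\<lambda>t. cnj (F t))"
proof -
  have "trunc R (\<lambda>u. cnj (f (- u))) = (\<lambda>u. cnj (trunc R f (- u)))" for R
    by (intro ext) (auto simp: trunc_def indicator_def)
  hence "cmod (fourier (trunc R (\<lambda>u. cnj (f (- u)))) t - cnj (F t)) = cmod (fourier (trunc R f) t - F t)" for R t
    by (simp add: fourier_cnj fourier_reflect flip: complex_cnj_diff)
  thus ?thesis
    using assms L2_cnj[OF L2_reflect, of f] by (simp add: is_fourier_def L2_conv_def L2_cnj)
qed

text \<open>The cutoffs are removed one at a time: with \<open>g\<close> truncated at
  \<open>S\<close>, the cutoff of \<open>f\<close> goes to infinity by continuity of the pairing,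
  and afterwards \<open>S\<close> does.\<close>

theorem is_fourier_exchange:
  assumes f: "is_fourier f F" and g: "is_fourier g G"
  shows "(LINT t|lborel. F t * g t) = (LINT u|lborel. f u * G u)"
proof -
  note L2 = is_fourier_L2[OF f] is_fourier_L2[OF g]
  have XL2: "h \<in> L2 lborel \<Longrightarrow> fourier (trunc R h) \<in> L2 lborel" for h R
    by (intro L2_fourier integrable_trunc L2_trunc)
  have half: "(LINT t|lborel. F t * trunc S g t) = (LINT u|lborel. f u * fourier (trunc S g) u)" for S
  proof (rule tendsto_unique[OF trivial_limit_at_top_linorder])
    show "((\<lambda>R. LINT t|lborel. fourier (trunc R f) t * trunc S g t) \<longlongrightarrow> (LINT t|lborel. F t * trunc S g t)) at_top"
      using f by (intro L2_conv_integral_mult XL2 L2_trunc L2) (simp add: is_fourier_def)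
    have "((\<lambda>R. LINT u|lborel. trunc R f u * fourier (trunc S g) u) \<longlongrightarrow>
        (LINT u|lborel. f u * fourier (trunc S g) u)) at_top"
      by (intro L2_conv_integral_mult L2_conv_trunc XL2 L2_trunc L2)
    thus "((\<lambda>R. LINT t|lborel. fourier (trunc R f) t * trunc S g t) \<longlongrightarrow>
        (LINT u|lborel. f u * fourier (trunc S g) u)) at_top"
      by (simp add: fourier_exchange integrable_trunc L2)
  qed
  show ?thesis
  proof (rule tendsto_unique[OF trivial_limit_at_top_linorder])
    show "((\<lambda>S. LINT t|lborel. F t * trunc S g t) \<longlongrightarrow> (LINT t|lborel. F t * g t)) at_top"
      unfolding mult.commute[of "F _"]
      by (intro L2_conv_integral_mult L2_conv_trunc L2_trunc L2)
    show "((\<lambda>S. LINT t|lborel. F t * trunc S g t) \<longlongrightarrow> (LINT u|lborel. f u * G u)) at_top"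
      unfolding half mult.commute[of "f _"]
      using g by (intro L2_conv_integral_mult XL2 L2) (simp add: is_fourier_def)
  qed
qed

section \<open>Inversion, surjectivity and the norm identity\<close>

text \<open>Closed intervals generate the Borel sets. The induction runs over truncations of
  \<open>h\<close>, which are integrable, so that complements and countable disjoint unions are
  legitimate.\<close>

lemma AE_zero_if_interval_integrals_zero:
  fixes h :: "real \<Rightarrow> complex"
  assumes h: "h \<in> L2 lborel"
    and zero: "\<And>a b. a \<le> b \<Longrightarrow> (LINT x|lborel. h x * indicator {a..b} x) = 0"
  shows "AE x in lborel. h x = 0"
proof -
  have "AE x in lborel. trunc (real n) h x = 0" for n
  proof (rule sigma_finite_measure.density_zero[OF sigma_finite_lborel integrable_trunc[OF h]])
    fix A :: "real set" assume "A \<in> sets lborel"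
    hence "A \<in> sets borel" by simp
    have int: "set_integrable lborel B (trunc (real n) h)" if "B \<in> sets borel" for B
      unfolding set_integrable_def using that by (intro integrable_mult_indicator integrable_trunc h) auto
    \<comment> \<open>The total integral, from which the complement case subtracts, is the interval
      integral of \<open>h\<close> over [-n, n].\<close>
    have univ: "(LINT x:UNIV|lborel. trunc (real n) h x) = 0"
      using zero[of "- real n" "real n"]
      by (simp add: set_lebesgue_integral_def trunc_def scaleR_conv_of_real of_real_indicator mult.commute)
    show "(LINT x:A|lborel. trunc (real n) h x) = 0"
      using \<open>A \<in> sets borel\<close>
    proof (induction rule: borel_set_induct)
      case empty
      show ?case by (simp add: set_lebesgue_integral_def)
    next
      case (interval a b)
      let ?a = "max a (- real n)" and ?b = "min b (real n)"
      have "(LINT x:{a..b}|lborel. trunc (real n) h x) = (LINT x|lborel. h x * indicator {?a..?b} x)"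
        unfolding set_lebesgue_integral_def
        by (intro Bochner_Integration.integral_cong refl) (auto simp: trunc_def indicator_def)
      also have "\<dots> = 0"
        by (cases "?a \<le> ?b") (simp add: zero, simp)
      finally show ?case .
    next
      case (compl A)
      have "(LINT x:A \<union> - A|lborel. trunc (real n) h x)
          = (LINT x:A|lborel. trunc (real n) h x) + (LINT x:- A|lborel. trunc (real n) h x)"
        by (intro set_integral_Un int) (use compl.hyps in auto)
      thus ?case using univ compl.IH by simp
    next
      case (union f)
      have "(LINT x:(\<Union>i. f i)|lborel. trunc (real n) h x) = (\<Sum>i. LINT x:f i|lborel. trunc (real n) h x)"
        by (intro lebesgue_integral_countable_add int)
           (use union.hyps in \<open>auto simp: disjoint_family_on_def\<close>)
      thus ?case using union.IH by simp
    qed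
  qed
  hence "AE x in lborel. \<forall>n. trunc (real n) h x = 0" by (simp add: AE_all_countable)
  thus ?thesis
  proof eventually_elim
    fix x assume "\<forall>n. trunc (real n) h x = 0"
    moreover obtain k :: nat where "\<bar>x\<bar> \<le> real k" using real_arch_simple by blast
    ultimately show "h x = 0" by (auto simp: trunc_def abs_le_iff dest: spec[of _ k])
  qed
qed

lemma fourier_indicator:
  assumes "a \<le> b" "t \<noteq> 0"
  shows "fourier (indicator {a..b}) t = (iexp (t * b) - iexp (t * a)) / (\<i> * t)"
proof -
  have "fourier (indicator {a..b}) t = (LINT x|lborel. indicator {a..b} x *\<^sub>R iexp (t * x))"
    unfolding fourier_def by (intro Bochner_Integration.integral_cong refl) (auto simp: indicator_def)
  also have "\<dots> = iexp (t * b) / (\<i> * t) - iexp (t * a) / (\<i> * t)"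
  proof (rule integral_FTC_atLeastAtMost[OF assms(1)])
    fix x
    show "((\<lambda>x. iexp (t * x) / (\<i> * t)) has_vector_derivative iexp (t * x)) (at x within {a..b})"
    proof -
      have "((\<lambda>x. exp (\<i> * of_real t * x) / (\<i> * t)) has_field_derivative exp (\<i> * of_real t * of_real x)) (at (of_real x))"
        by (rule derivative_eq_intros refl | simp add: assms(2))+
      from has_vector_derivative_real_field[OF this] show ?thesis by (simp add: mult_ac)
    qed
  qed (intro continuous_intros)
  finally show ?thesis by (simp add: diff_divide_distrib)
qed

lemma is_fourier_indicator:
  "is_fourier (indicator {a..b}) (fourier (indicator {a..b}))"
proof -
  let ?c = "indicator {a..b} :: real \<Rightarrow> complex"
  have "integrable lborel ?c"
    using L2_integrable_mult[OF L2_indicator[of a b] L2_indicator[of a b]]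
    by (simp flip: indicator_inter_arith)
  moreover have "\<forall>\<^sub>F R in at_top. trunc R ?c = ?c"
    using eventually_ge_at_top[of "max \<bar>a\<bar> \<bar>b\<bar>"]
    by eventually_elim (auto simp: trunc_def indicator_def fun_eq_iff)
  hence "L2_conv lborel (\<lambda>R. fourier (trunc R ?c)) (fourier ?c) at_top"
    unfolding L2_conv_def by (intro tendsto_eventually) (auto elim: eventually_mono)
  ultimately show ?thesis by (simp add: is_fourier_def L2_indicator L2_fourier)
qed

text \<open>The Levy inversion formula for a point mass is the Dirichlet integral needed here.\<close>

lemma fourier_inversion_indicator:
  assumes "a \<le> b" and Y: "is_fourier (fourier (indicator {a..b})) Y"
  shows "AE u in lborel. Y u = of_real (2 * pi) * indicator {a..b} (- u)"
proof -
  let ?X = "fourier (indicator {a..b})"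
  note [measurable] = is_fourier_L2(2)[OF Y, THEN L2_lborel_measurable]
  have "L2_conv lborel (\<lambda>n. fourier (trunc (real n) ?X)) Y sequentially"
    using Y unfolding is_fourier_def by (intro L2_conv_compose[OF _ filterlim_real_sequentially]) auto
  moreover have "AE u in lborel. (\<lambda>n. fourier (trunc (real n) ?X) u) \<longlonglongrightarrow> of_real (2 * pi) * indicator {a..b} (- u)"
  proof -
    \<comment> \<open>Levy's formula requires that the endpoints of the interval carry no mass; for
      the point mass at \<open>u\<close> this excludes two values.\<close>
    have "AE u in lborel. u \<noteq> - a \<and> u \<noteq> - b"
      using AE_lborel_singleton[of "- a"] AE_lborel_singleton[of "- b"] by eventually_elim simp
    thus ?thesis
    proof eventually_elim
      fix u :: real assume u: "u \<noteq> - a \<and> u \<noteq> - b"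
      \<comment> \<open>The characteristic function of the point mass at \<open>u\<close> is the
        Fourier kernel itself, so Levy's truncated integral is the truncated Fourier integral at
        \<open>u\<close>.\<close>
      interpret real_distribution "return borel u"
        by (simp add: real_distribution_def real_distribution_axioms_def prob_space_return)
      have char: "char (return borel u) t = iexp (t * u)" for t
        unfolding char_def by (subst integral_return) auto
      \<comment> \<open>Levy's exponentials carry a negative sign. Taking the reflected endpoints -b
        and -a restores the transform of the indicator of [a, b] and explains the argument -u in the
        limit.\<close>
      let ?g = "\<lambda>t. (iexp (- (t * - b)) - iexp (- (t * - a))) / (\<i> * t) * char (return borel u) t"
      have "(\<lambda>n. 1 / (2 * pi) * (CLBINT t=-n..n. ?g t)) \<longlonglongrightarrow> of_real (measure (return borel u) {- b<..- a})"
        by (rule Levy_Inversion) (use assms u in \<open>auto simp: measure_return\<close>)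
      from tendsto_mult[OF tendsto_const[of "complex_of_real (2 * pi)"] this]
      have lim: "(\<lambda>n. CLBINT t=-real n..real n. ?g t)
          \<longlonglongrightarrow> of_real (2 * pi) * of_real (measure (return borel u) {- b<..- a})"
        by simp
      have "(CLBINT t=-real n..real n. ?g t) = fourier (trunc (real n) ?X) u" for n
      proof -
        have "(CLBINT t=-real n..real n. ?g t) = (CLBINT t:{-real n..real n}. ?g t)"
          using interval_integral_Icc[of "- real n" "real n" ?g] by simp
        also have "\<dots> = fourier (trunc (real n) ?X) u"
          unfolding fourier_def[of "trunc (real n) ?X"] set_lebesgue_integral_def
        proof (intro integral_cong_AE)
          \<comment> \<open>At t = 0 the quotient has the value 0 by division by zero and need not
            equal the transform; a single point does not affect the integral.\<close>
          show "AE t in lborel. indicator {- real n..real n} t *\<^sub>R ?g t = iexp (u * t) * trunc (real n) ?X t"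
            using AE_lborel_singleton[of 0]
            by eventually_elim (simp add: trunc_def fourier_indicator assms char mult_ac)
        qed (auto simp: char)
        finally show ?thesis .
      qed
      moreover have "measure (return borel u) {- b<..- a} = indicator {a..b} (- u)"
        using u by (auto simp: measure_return indicator_def)
      ultimately show "(\<lambda>n. fourier (trunc (real n) ?X) u) \<longlonglongrightarrow> of_real (2 * pi) * indicator {a..b} (- u)"
        using lim by (auto simp: indicator_def of_bool_def)
    qed
  qed
  ultimately show ?thesis by (rule L2_conv_pointwise_unique) auto
qed

text \<open>Tested against an indicator, two exchanges move both transformations from
  \<open>f\<close> to the indicator, where the inversion is known. Since interval integrals
  determine a square-integrable function, this suffices.\<close>

theorem fourier_inversion:
  assumes F: "is_fourier f F" and H: "is_fourier F H"
  shows "AE u in lborel. H u = of_real (2 * pi) * f (- u)"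
proof -
  note L2 = is_fourier_L2[OF F] is_fourier_L2[OF H]
  have L2': "(\<lambda>u. of_real (2 * pi) * f (- u)) \<in> L2 lborel"
    by (rule L2_cmult[OF L2_reflect[OF L2(1)]])
  have "AE u in lborel. H u - of_real (2 * pi) * f (- u) = 0"
  proof (rule AE_zero_if_interval_integrals_zero)
    show "(\<lambda>u. H u - of_real (2 * pi) * f (- u)) \<in> L2 lborel" by (intro L2_diff L2 L2')
    fix a b :: real assume "a \<le> b"
    let ?c = "indicator {a..b} :: real \<Rightarrow> complex"
    have X: "is_fourier ?c (fourier ?c)" by (rule is_fourier_indicator)
    obtain Y where Y: "is_fourier (fourier ?c) Y"
      using is_fourier_exists is_fourier_L2(2)[OF X] by blast
    note [measurable] = L2_lborel_measurable[OF L2(1)] L2_lborel_measurable[OF is_fourier_L2(2)[OF Y]]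
    have "(LINT u|lborel. H u * ?c u) = (LINT t|lborel. F t * fourier ?c t)"
      by (rule is_fourier_exchange[OF H X])
    also have "\<dots> = (LINT u|lborel. f u * Y u)"
      by (rule is_fourier_exchange[OF F Y])
    also have "\<dots> = (LINT u|lborel. f u * (of_real (2 * pi) * ?c (- u)))"
      by (rule integral_cong_AE) (use fourier_inversion_indicator[OF \<open>a \<le> b\<close> Y] in auto)
    also have "\<dots> = (LINT u|lborel. (of_real (2 * pi) * f (- u)) * ?c u)"
      using lborel_integral_reflect[of "\<lambda>u. f u * (of_real (2 * pi) * ?c (- u))"] by (simp add: mult_ac)
    finally have "(LINT u|lborel. H u * ?c u) = (LINT u|lborel. (of_real (2 * pi) * f (- u)) * ?c u)" .
    thus "(LINT u|lborel. (H u - of_real (2 * pi) * f (- u)) * ?c u) = 0"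
      unfolding left_diff_distrib
      by (subst Bochner_Integration.integral_diff[OF L2_integrable_mult[OF L2(4) L2_indicator]
            L2_integrable_mult[OF L2' L2_indicator]]) simp
  qed
  thus ?thesis by simp
qed

text \<open>Inversion names the preimage: the transform of \<open>F\<close>, reflected and divided
  by 2 pi.\<close>

theorem is_fourier_surj:
  assumes "F \<in> L2 lborel" shows "\<exists>f. is_fourier f F"
proof -
  obtain H where H: "is_fourier F H" using is_fourier_exists[OF assms] by blast
  obtain K where K: "is_fourier H K" using is_fourier_exists is_fourier_L2(2)[OF H] by blast
  note [measurable] = L2_lborel_measurable[OF assms] L2_lborel_measurable[OF is_fourier_L2(2)[OF H]]
    L2_lborel_measurable[OF is_fourier_L2(2)[OF K]]
  let ?f = "\<lambda>u. of_real (1 / (2 * pi)) * H (- u)"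
  have "is_fourier ?f (\<lambda>t. of_real (1 / (2 * pi)) * K (- t))"
    by (intro is_fourier_cmult is_fourier_reflect K)
  moreover have "AE t in lborel. of_real (1 / (2 * pi)) * K (- t) = F t"
  proof -
    have "AE t in lborel. K t = of_real (2 * pi) * F (- t)" by (rule fourier_inversion[OF H K])
    hence "AE t in distr lborel borel uminus. K t = of_real (2 * pi) * F (- t)"
      by (simp only: lborel_distr_uminus)
    hence "AE t in lborel. K (- t) = of_real (2 * pi) * F t"
      by (subst (asm) AE_distr_iff) auto
    thus ?thesis by eventually_elim simp
  qed
  ultimately have "is_fourier ?f F"
    by (rule is_fourier_cong[OF _ AE_I2[OF refl]]) measurable
  thus ?thesis by blast
qed

text \<open>The conjugate of \<open>G\<close> is the transform of the reflected conjugate of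
  \<open>g\<close>. Exchanging transforms it once more, and inversion cancels the reflection and
  leaves 2 pi times the conjugate of \<open>g\<close>.\<close>

theorem fourier_plancherel:
  assumes f: "is_fourier f F" and g: "is_fourier g G"
  shows "L2_inner lborel F G = of_real (2 * pi) * L2_inner lborel f g"
proof -
  have G: "is_fourier (\<lambda>u. cnj (g (- u))) (\<lambda>t. cnj (G t))" by (rule is_fourier_cnj_reflect[OF g])
  obtain H where H: "is_fourier (\<lambda>t. cnj (G t)) H"
    using is_fourier_exists is_fourier_L2(2)[OF G] by blast
  note [measurable] = L2_lborel_measurable[OF is_fourier_L2(1)[OF f]]
    L2_lborel_measurable[OF is_fourier_L2(1)[OF g]] L2_lborel_measurable[OF is_fourier_L2(2)[OF H]]
  have "L2_inner lborel F G = (LINT u|lborel. f u * H u)"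
    unfolding L2_inner_def by (rule is_fourier_exchange[OF f H])
  also have "\<dots> = (LINT u|lborel. f u * (of_real (2 * pi) * cnj (g u)))"
    by (rule integral_cong_AE) (use fourier_inversion[OF G H] in auto)
  also have "\<dots> = (LINT u|lborel. of_real (2 * pi) * (f u * cnj (g u)))"
    by (simp add: mult_ac)
  finally show ?thesis by (simp add: L2_inner_def)
qed


section \<open>From the Fourier to the Mellin transformation\<close>

lemma borel_measurable_half_line: "f \<in> borel_measurable borel \<Longrightarrow> f \<in> borel_measurable half_line"
  by (intro measurable_restrict_space1) simp

lemma measurable_exp_half_line [measurable]: "(exp :: real \<Rightarrow> real) \<in> borel \<rightarrow>\<^sub>M half_line"
  by (intro measurable_restrict_space2) auto

text \<open>Substitution is applied on compact intervals [-n-1, n+1]; their images under exp exhaust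
  the half-line, and continuity of measures from below gives the full integral.\<close>

lemma nn_integral_half_line_borel:
  fixes f :: "real \<Rightarrow> ennreal"
  assumes [measurable]: "f \<in> borel_measurable borel"
  shows "(\<integral>\<^sup>+x. f x \<partial>half_line) = (\<integral>\<^sup>+u. f (exp u) * ennreal (exp u) \<partial>lborel)"
proof -
  define A where "A n = {exp (- real (Suc n))..exp (real (Suc n))}" for n
  define B where "B n = {- real (Suc n)..real (Suc n)}" for n
  let ?g = "\<lambda>u. f (exp u) * ennreal (exp u)"
  have UA: "(\<Union>n. A n) = {0<..}"
  proof (intro equalityI subsetI)
    fix x :: real assume "x \<in> {0<..}"
    hence "x > 0" by simp
    obtain n :: nat where "\<bar>ln x\<bar> \<le> real n" using real_arch_simple by blast
    hence "- real (Suc n) \<le> ln x" "ln x \<le> real (Suc n)" by auto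
    hence "x \<in> A n"
      using \<open>x > 0\<close> unfolding A_def by (metis atLeastAtMost_iff exp_le_cancel_iff exp_ln)
    thus "x \<in> (\<Union>n. A n)" by blast
  qed (auto simp: A_def intro: less_le_trans[OF exp_gt_zero])
  have UB: "(\<Union>n. B n) = UNIV"
  proof (intro equalityI subsetI)
    fix x :: real
    obtain n :: nat where "\<bar>x\<bar> \<le> real n" using real_arch_simple by blast
    hence "x \<in> B n" by (auto simp: B_def)
    thus "x \<in> (\<Union>n. B n)" by blast
  qed auto
  have AB: "emeasure (density lborel f) (A n) = emeasure (density lborel ?g) (B n)" for n
  proof -
    have "(\<integral>\<^sup>+x. f x * indicator {exp (- real (Suc n))..exp (real (Suc n))} x \<partial>lborel) =
        (\<integral>\<^sup>+x. f (exp x) * ennreal (exp x) * indicator {- real (Suc n)..real (Suc n)} x \<partial>lborel)"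
      by (rule nn_integral_substitution_aux) (auto intro!: derivative_eq_intros continuous_intros)
    thus ?thesis by (simp add: emeasure_density A_def B_def)
  qed
  have "(\<integral>\<^sup>+x. f x \<partial>half_line) = emeasure (density lborel f) (\<Union>n. A n)"
    unfolding UA by (simp add: nn_integral_restrict_space emeasure_density)
  also have "\<dots> = (SUP n. emeasure (density lborel f) (A n))"
    by (rule SUP_emeasure_incseq[symmetric]) (auto simp: A_def incseq_def intro: order_trans[rotated])
  also have "\<dots> = (SUP n. emeasure (density lborel ?g) (B n))" by (simp only: AB)
  also have "\<dots> = emeasure (density lborel ?g) (\<Union>n. B n)"
    by (rule SUP_emeasure_incseq) (auto simp: B_def incseq_def)
  finally show ?thesis by (simp add: UB emeasure_density)
qed

text \<open>The substitution x = exp u as an identity of measures yields the rules for nonnegative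
  integrals, complex integrals and null sets at once.\<close>

lemma half_line_eq_distr: "half_line = distr (density lborel (\<lambda>u. ennreal (exp u))) half_line exp"
proof (rule measure_eqI)
  fix A assume A: "A \<in> sets half_line"
  hence [measurable]: "A \<in> sets borel" and "A \<subseteq> {0<..}"
    by (auto simp: sets_restrict_space)
  have "emeasure half_line A = (\<integral>\<^sup>+x. indicator A x \<partial>half_line)"
    using A by simp
  also have "\<dots> = (\<integral>\<^sup>+u. indicator A (exp u) * ennreal (exp u) \<partial>lborel)"
    by (rule nn_integral_half_line_borel) measurable
  also have "\<dots> = (\<integral>\<^sup>+u. ennreal (exp u) * indicator (exp -` A) u \<partial>lborel)"
    by (intro nn_integral_cong) (auto simp: indicator_def)
  also have "\<dots> = emeasure (density lborel (\<lambda>u. ennreal (exp u))) (exp -` A)"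
    by (rule emeasure_density[symmetric]) (use measurable_sets_borel[of exp borel A] in auto)
  also have "\<dots> = emeasure (distr (density lborel (\<lambda>u. ennreal (exp u))) half_line exp) A"
    using A by (subst emeasure_distr) auto
  finally show "emeasure half_line A = emeasure (distr (density lborel (\<lambda>u. ennreal (exp u))) half_line exp) A" .
qed simp

lemma nn_integral_half_line:
  assumes [measurable]: "f \<in> borel_measurable half_line"
  shows "(\<integral>\<^sup>+x. f x \<partial>half_line) = (\<integral>\<^sup>+u. ennreal (exp u) * f (exp u) \<partial>lborel)"
  by (subst half_line_eq_distr) (simp add: nn_integral_distr nn_integral_density)

lemma integral_half_line:
  fixes f :: "real \<Rightarrow> complex"
  assumes [measurable]: "f \<in> borel_measurable half_line"
  shows "(LINT x|half_line. f x) = (LINT u|lborel. exp u *\<^sub>R f (exp u))"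
  by (subst half_line_eq_distr) (simp add: integral_distr integral_density)

text \<open>The factor is the square root of the Jacobian exp u. It preserves the norm and absorbs
  the real part 1/2 of the exponent in the Mellin kernel.\<close>

definition to_line :: "(real \<Rightarrow> complex) \<Rightarrow> real \<Rightarrow> complex" where
  "to_line f u = of_real (exp (u / 2)) * f (exp u)"

lemma measurable_to_line [measurable]:
  assumes [measurable]: "f \<in> borel_measurable half_line"
  shows "to_line f \<in> borel_measurable borel"
  unfolding to_line_def[abs_def] by measurable

lemma exp_half_square: "exp (u / 2) * exp (u / 2) = exp (u :: real)"
  by (simp flip: exp_add)

lemma L2_to_line_iff:
  assumes [measurable]: "f \<in> borel_measurable half_line"
  shows "to_line f \<in> L2 lborel \<longleftrightarrow> f \<in> L2 half_line"
proof -
  have "(\<integral>\<^sup>+x. ennreal ((cmod (f x))\<^sup>2) \<partial>half_line) = (\<integral>\<^sup>+u. ennreal ((cmod (to_line f u))\<^sup>2) \<partial>lborel)"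
    by (subst nn_integral_half_line)
       (auto simp: to_line_def norm_mult power_mult_distrib exp_half_square power2_eq_square
          simp flip: ennreal_mult intro!: nn_integral_cong)
  thus ?thesis by (simp add: mem_L2_iff)
qed

lemma L2_to_line: "f \<in> L2 half_line \<Longrightarrow> to_line f \<in> L2 lborel"
  using L2_to_line_iff L2_measurable by blast

lemma to_line_surj:
  assumes "h \<in> L2 lborel" shows "\<exists>f\<in>L2 half_line. to_line f = h"
proof -
  note [measurable] = L2_lborel_measurable[OF assms]
  let ?f = "\<lambda>x. h (ln x) / of_real (sqrt x)"
  have [measurable]: "?f \<in> borel_measurable half_line"
    by (intro borel_measurable_half_line) measurable
  have "sqrt (exp u) = exp (u / 2)" for u :: real
    by (rule real_sqrt_unique) (simp_all add: power2_eq_square exp_half_square)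
  hence "to_line ?f = h" by (simp add: to_line_def fun_eq_iff)
  moreover from this have "?f \<in> L2 half_line" using assms by (subst L2_to_line_iff[symmetric]) auto
  ultimately show ?thesis by blast
qed

lemma L2_inner_to_line:
  assumes "f \<in> L2 half_line" "g \<in> L2 half_line"
  shows "L2_inner lborel (to_line f) (to_line g) = L2_inner half_line f g"
proof -
  note [measurable] = assms[THEN L2_measurable]
  have "exp u *\<^sub>R (f (exp u) * cnj (g (exp u))) = to_line f u * cnj (to_line g u)" for u
  proof -
    have "exp u *\<^sub>R (f (exp u) * cnj (g (exp u)))
        = of_real (exp (u / 2) * exp (u / 2)) * (f (exp u) * cnj (g (exp u)))"
      by (simp only: exp_half_square scaleR_conv_of_real)
    thus ?thesis by (simp add: to_line_def mult_ac)
  qed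
  thus ?thesis unfolding L2_inner_def by (subst integral_half_line) auto
qed

lemma AE_half_line_iff:
  assumes "Measurable.pred half_line P"
  shows "(AE x in half_line. P x) \<longleftrightarrow> (AE u in lborel. P (exp u))"
proof -
  have "(AE x in half_line. P x) \<longleftrightarrow> (AE x in distr (density lborel (\<lambda>u. ennreal (exp u))) half_line exp. P x)"
    by (subst (1) half_line_eq_distr) (rule refl)
  also have "\<dots> \<longleftrightarrow> (AE u in density lborel (\<lambda>u. ennreal (exp u)). P (exp u))"
    using assms by (intro AE_distr_iff) (auto simp: pred_def)
  finally show ?thesis by (simp add: AE_density)
qed

lemma AE_to_line_eq_iff:
  assumes [measurable]: "f \<in> borel_measurable half_line" "g \<in> borel_measurable half_line"
  shows "(AE u in lborel. to_line f u = to_line g u) \<longleftrightarrow> (AE x in half_line. f x = g x)"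
  by (subst AE_half_line_iff) (auto simp: to_line_def)

text \<open>For x = exp u and s = 1/2 + it the Jacobian raises x^(s-1) to x^s = exp (itu) exp (u/2),
  and the logarithm maps [1/n, n] to [-ln n, ln n].\<close>

lemma mellin_truncation_eq_fourier:
  assumes [measurable]: "f \<in> borel_measurable half_line" and "n > 0"
  shows "mellin (\<lambda>x. indicator {1 / real n..real n} x *\<^sub>R f x) (Complex (1/2) t)
    = fourier (trunc (ln (real n)) (to_line f)) t"
proof -
  \<comment> \<open>On the half-line the complex power is an exponential of the real logarithm,
    which is measurable.\<close>
  have [measurable]: "(\<lambda>x. complex_of_real x powr (Complex (1/2) t - 1)) \<in> borel_measurable half_line"
  proof (rule measurable_cong[THEN iffD1])
    show "(\<lambda>x. exp ((Complex (1/2) t - 1) * of_real (ln x))) \<in> borel_measurable half_line"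
      by (intro borel_measurable_half_line) measurable
    show "exp ((Complex (1/2) t - 1) * of_real (ln x)) = complex_of_real x powr (Complex (1/2) t - 1)"
      if "x \<in> space half_line" for x
      using that by (simp add: powr_def Ln_of_real space_restrict_space)
  qed
  have [measurable]: "(\<lambda>x. indicator {1 / real n..real n} x :: real) \<in> borel_measurable half_line"
    by (intro measurable_restrict_space1) measurable
  have "mellin (\<lambda>x. indicator {1 / real n..real n} x *\<^sub>R f x) (Complex (1/2) t) =
    (LINT u|lborel. exp u *\<^sub>R (of_real (exp u) powr (Complex (1/2) t - 1) *
       (indicator {1 / real n..real n} (exp u) *\<^sub>R f (exp u))))"
    unfolding mellin_def by (rule integral_half_line) measurable
  also have "\<dots> = (LINT u|lborel. iexp (t * u) * trunc (ln (real n)) (to_line f) u)"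
  proof (intro Bochner_Integration.integral_cong refl)
    fix u :: real
    have "complex_of_real (exp u) powr (Complex (1/2) t - 1) = exp ((Complex (1/2) t - 1) * of_real u)"
      by (simp add: powr_def Ln_of_real)
    hence "of_real (exp u) * complex_of_real (exp u) powr (Complex (1/2) t - 1)
        = exp (of_real u + (Complex (1/2) t - 1) * of_real u)"
      by (simp add: exp_add exp_of_real)
    also have "of_real u + (Complex (1/2) t - 1) * of_real u = \<i> * of_real (t * u) + of_real (u / 2)"
      by (simp add: complex_eq_iff)
    also have "exp \<dots> = iexp (t * u) * of_real (exp (u / 2))"
      by (simp only: exp_add exp_of_real)
    finally have 1: "of_real (exp u) * complex_of_real (exp u) powr (Complex (1/2) t - 1)
        = iexp (t * u) * of_real (exp (u / 2))" .
    have "1 / real n = exp (- ln (real n))" "real n = exp (ln (real n))"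
      using assms(2) by (simp_all add: exp_minus inverse_eq_divide)
    hence "exp u \<in> {1 / real n..real n} \<longleftrightarrow> u \<in> {- ln (real n)..ln (real n)}"
      by (metis atLeastAtMost_iff exp_le_cancel_iff)
    hence 2: "indicator {1 / real n..real n} (exp u) = (indicator {- ln (real n)..ln (real n)} u :: real)"
      by (simp add: indicator_def)
    have "exp u *\<^sub>R (of_real (exp u) powr (Complex (1/2) t - 1) *
       (indicator {1 / real n..real n} (exp u) *\<^sub>R f (exp u))) =
       (of_real (exp u) * complex_of_real (exp u) powr (Complex (1/2) t - 1)) *
       (indicator {1 / real n..real n} (exp u) *\<^sub>R f (exp u))"
      by (simp add: scaleR_conv_of_real mult_ac)
    also have "\<dots> = iexp (t * u) * trunc (ln (real n)) (to_line f) u"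
      unfolding 1 2 trunc_def to_line_def by (simp add: mult_ac)
    finally show "exp u *\<^sub>R (of_real (exp u) powr (Complex (1/2) t - 1) *
       (indicator {1 / real n..real n} (exp u) *\<^sub>R f (exp u))) =
       iexp (t * u) * trunc (ln (real n)) (to_line f) u" .
  qed
  finally show ?thesis by (simp add: fourier_def)
qed

text \<open>The Mellin limit runs only along the cutoffs ln n. Conversely, some transform exists for
  all real cutoffs, and uniqueness of the limit along ln n identifies it almost everywhere.\<close>

lemma is_L2_mellin_iff_fourier:
  "is_L2_mellin f F \<longleftrightarrow> f \<in> L2 half_line \<and> is_fourier (to_line f) F"
proof (cases "f \<in> L2 half_line")
  case True
  note [measurable] = L2_measurable[OF True] L2_lborel_measurable[OF L2_to_line[OF True]]
  have ln: "filterlim (\<lambda>n. ln (real n)) at_top sequentially"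
    by (intro filterlim_compose[OF ln_at_top] filterlim_real_sequentially)
  let ?X = "\<lambda>n. fourier (trunc (ln (real n)) (to_line f))"
  let ?Y = "\<lambda>n t. mellin (\<lambda>x. indicator {1 / real n..real n} x *\<^sub>R f x) (Complex (1/2) t)"
  \<comment> \<open>The index 0 is left out, since 1/n = exp (- ln n) fails there.\<close>
  have XY: "\<forall>\<^sub>F n in sequentially. ?Y n = ?X n"
    using eventually_gt_at_top[of 0]
    by eventually_elim (simp add: mellin_truncation_eq_fourier fun_eq_iff)
  have "L2_conv lborel ?Y F sequentially \<longleftrightarrow> L2_conv lborel ?X F sequentially"
    unfolding L2_conv_def
    by (intro filterlim_cong refl) (use XY in eventually_elim, simp add: fun_eq_iff)
  moreover have "is_fourier (to_line f) F" if F: "F \<in> L2 lborel" "L2_conv lborel ?X F sequentially"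
  proof -
    obtain G where G: "is_fourier (to_line f) G"
      using is_fourier_exists[OF L2_to_line[OF True]] by blast
    note [measurable] = L2_lborel_measurable[OF F(1)] L2_lborel_measurable[OF is_fourier_L2(2)[OF G]]
    have "L2_conv lborel ?X G sequentially"
      using G unfolding is_fourier_def by (intro L2_conv_compose[OF _ ln]) auto
    hence "AE t in lborel. G t = F t"
      by (rule L2_conv_unique_AE[OF _ F(2)]) auto
    with G show ?thesis by (rule is_fourier_cong[OF _ AE_I2[OF refl]]) measurable
  qed
  moreover have "L2_conv lborel ?X F sequentially" if "is_fourier (to_line f) F"
    using that unfolding is_fourier_def by (intro L2_conv_compose[OF _ ln]) auto
  ultimately show ?thesis
    using True unfolding is_L2_mellin_def L2_conv_def by (auto simp: is_fourier_def)
qed (simp add: is_L2_mellin_def)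

section \<open>Mellin-Plancherel theory on the half-line\<close>

lemma is_L2_mellin_L2:
  "is_L2_mellin f F \<Longrightarrow> f \<in> L2 half_line" "is_L2_mellin f F \<Longrightarrow> F \<in> L2 lborel"
  by (auto simp: is_L2_mellin_def)

lemma is_L2_mellin_exists: "f \<in> L2 half_line \<Longrightarrow> \<exists>F. is_L2_mellin f F"
  using is_fourier_exists[OF L2_to_line] by (auto simp: is_L2_mellin_iff_fourier)

lemma is_L2_mellin_surj:
  assumes "F \<in> L2 lborel" shows "\<exists>f. is_L2_mellin f F"
proof -
  obtain h where h: "is_fourier h F" using is_fourier_surj[OF assms] by blast
  then obtain f where "f \<in> L2 half_line" "to_line f = h"
    using to_line_surj is_fourier_L2(1) by blast
  with h show ?thesis by (auto simp: is_L2_mellin_iff_fourier)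
qed

theorem mellin_plancherel:
  assumes "is_L2_mellin f F" "is_L2_mellin g G"
  shows "L2_inner lborel F G = of_real (2 * pi) * L2_inner half_line f g"
  using assms fourier_plancherel[of "to_line f" F "to_line g" G]
  by (simp add: is_L2_mellin_iff_fourier L2_inner_to_line)

lemma is_L2_mellin_cong:
  assumes f: "is_L2_mellin f F" "L2_eq half_line f g"
    and F: "AE t in lborel. F t = G t" and [measurable]: "G \<in> borel_measurable borel"
  shows "is_L2_mellin g G"
proof -
  from f(2) have g: "g \<in> L2 half_line" and ae: "AE x in half_line. f x = g x" by (auto simp: L2_eq_def)
  note [measurable] = L2_measurable[OF is_L2_mellin_L2(1)[OF f(1)]] L2_measurable[OF g]
  have "AE u in lborel. to_line f u = to_line g u" using ae by (simp add: AE_to_line_eq_iff)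
  with f(1) g show ?thesis
    unfolding is_L2_mellin_iff_fourier by (auto intro!: is_fourier_cong[OF _ _ F])
qed

lemma is_L2_mellin_unique:
  "is_L2_mellin f F \<Longrightarrow> is_L2_mellin f G \<Longrightarrow> AE t in lborel. F t = G t"
  by (auto simp: is_L2_mellin_iff_fourier intro: is_fourier_unique)

lemma is_L2_mellin_linear:
  assumes f: "is_L2_mellin f F" and g: "is_L2_mellin g G"
  shows "is_L2_mellin (\<lambda>x. a * f x + b * g x) (\<lambda>t. a * F t + b * G t)"
proof -
  have "to_line (\<lambda>x. a * f x + b * g x) = (\<lambda>u. a * to_line f u + b * to_line g u)"
    by (simp add: to_line_def fun_eq_iff algebra_simps)
  thus ?thesis
    using f g by (auto simp: is_L2_mellin_iff_fourier intro!: L2_add L2_cmult is_fourier_add is_fourier_cmult)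
qed

lemma L2_inner_self_eq_0_iff:
  assumes "f \<in> L2 M"
  shows "L2_inner M f f = 0 \<longleftrightarrow> (AE x in M. f x = 0)"
  using assms by (auto simp: L2_inner_self L2_def integral_nonneg_eq_0_iff_AE)

text \<open>The norm identity, applied to the difference, turns a vanishing transform into a
  vanishing function.\<close>

lemma is_L2_mellin_inj:
  assumes f: "is_L2_mellin f F" and g: "is_L2_mellin g G" and "AE t in lborel. F t = G t"
  shows "L2_eq half_line f g"
proof -
  have d: "is_L2_mellin (\<lambda>x. 1 * f x + - 1 * g x) (\<lambda>t. 1 * F t + - 1 * G t)"
    by (rule is_L2_mellin_linear[OF f g])
  have "AE t in lborel. 1 * F t + - 1 * G t = 0" using assms(3) by eventually_elim simp
  hence "L2_inner half_line (\<lambda>x. 1 * f x + - 1 * g x) (\<lambda>x. 1 * f x + - 1 * g x) = 0"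
    using mellin_plancherel[OF d d] L2_inner_self_eq_0_iff[OF is_L2_mellin_L2(2)[OF d]] by simp
  hence "AE x in half_line. 1 * f x + - 1 * g x = 0"
    using L2_inner_self_eq_0_iff[OF is_L2_mellin_L2(1)[OF d]] by blast
  thus ?thesis using is_L2_mellin_L2(1)[OF f] is_L2_mellin_L2(1)[OF g] by (simp add: L2_eq_def)
qed


section \<open>Mellin multipliers\<close>

lemma mellin_multiplier_L2:
  "mellin_multiplier m f g \<Longrightarrow> f \<in> L2 half_line" "mellin_multiplier m f g \<Longrightarrow> g \<in> L2 half_line"
  by (auto simp: mellin_multiplier_def dest: is_L2_mellin_L2)

text \<open>Uniqueness and injectivity of the Mellin transformation modulo null sets make the graph
  independent of representatives and single-valued on classes.\<close>

lemma mellin_multiplier_operator: "L2_operator half_line (mellin_multiplier m)"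
  unfolding L2_operator_def
proof (intro conjI allI impI)
  fix f g assume A: "mellin_multiplier m f g"
  then show "f \<in> L2 half_line" "g \<in> L2 half_line"
    by (rule mellin_multiplier_L2)+
next
  fix f f' g g' assume "mellin_multiplier m f g \<and> L2_eq half_line f f'"
  then obtain F G where F: "is_L2_mellin f F" and G: "is_L2_mellin g G"
    and m: "AE t in lborel. G t = m (Complex (1/2) t) * F t" and ff': "L2_eq half_line f f'"
    by (auto simp: mellin_multiplier_def)
  note meas = L2_lborel_measurable[OF is_L2_mellin_L2(2)[OF F]] L2_lborel_measurable[OF is_L2_mellin_L2(2)[OF G]]
  have F': "is_L2_mellin f' F"
    using F ff' AE_I2[OF refl] meas(1) by (rule is_L2_mellin_cong)
  show "mellin_multiplier m f' g' \<longleftrightarrow> L2_eq half_line g g'"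
  proof
    assume "mellin_multiplier m f' g'"
    then obtain F1 G1 where F1: "is_L2_mellin f' F1" and G1: "is_L2_mellin g' G1"
      and m1: "AE t in lborel. G1 t = m (Complex (1/2) t) * F1 t"
      by (auto simp: mellin_multiplier_def)
    have "AE t in lborel. G t = G1 t"
      using m m1 is_L2_mellin_unique[OF F' F1] by eventually_elim simp
    with G G1 show "L2_eq half_line g g'" by (rule is_L2_mellin_inj)
  next
    assume "L2_eq half_line g g'"
    with G have "is_L2_mellin g' G" using AE_I2[OF refl] meas(2) by (rule is_L2_mellin_cong)
    with F' m show "mellin_multiplier m f' g'" by (auto simp: mellin_multiplier_def)
  qed
next
  fix a b f f' g g' assume "mellin_multiplier m f g \<and> mellin_multiplier m f' g'"
  then obtain F G F' G' where *: "is_L2_mellin f F" "is_L2_mellin g G" "is_L2_mellin f' F'" "is_L2_mellin g' G'"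
    and m: "AE t in lborel. G t = m (Complex (1/2) t) * F t" "AE t in lborel. G' t = m (Complex (1/2) t) * F' t"
    by (auto simp: mellin_multiplier_def)
  have "AE t in lborel. a * G t + b * G' t = m (Complex (1/2) t) * (a * F t + b * F' t)"
    using m by eventually_elim (simp add: algebra_simps)
  with * show "mellin_multiplier m (\<lambda>x. a * f x + b * f' x) (\<lambda>x. a * g x + b * g' x)"
    unfolding mellin_multiplier_def by (blast intro: is_L2_mellin_linear)
qed

lemma L2_mult_unimodular:
  assumes F: "F \<in> L2 lborel" and [measurable]: "m \<in> borel_measurable borel"
    and m: "AE t in lborel. cmod (m t) = 1"
  shows "(\<lambda>t. m t * F t) \<in> L2 lborel"
proof -
  note [measurable] = L2_lborel_measurable[OF F]
  have "(\<integral>\<^sup>+t. ennreal ((cmod (m t * F t))\<^sup>2) \<partial>lborel) = (\<integral>\<^sup>+t. ennreal ((cmod (F t))\<^sup>2) \<partial>lborel)"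
    by (intro nn_integral_cong_AE) (use m in eventually_elim, simp add: norm_mult)
  thus ?thesis using F by (simp add: mem_L2_iff)
qed

lemma mellin_multiplier_total:
  assumes "(\<lambda>t. m (Complex (1/2) t)) \<in> borel_measurable borel"
    and "AE t in lborel. cmod (m (Complex (1/2) t)) = 1" and "f \<in> L2 half_line"
  shows "\<exists>g. mellin_multiplier m f g"
proof -
  obtain F where F: "is_L2_mellin f F" using is_L2_mellin_exists assms(3) by blast
  then obtain g where "is_L2_mellin g (\<lambda>t. m (Complex (1/2) t) * F t)"
    using is_L2_mellin_surj L2_mult_unimodular[OF is_L2_mellin_L2(2)[OF F] assms(1,2)] by blast
  with F show ?thesis unfolding mellin_multiplier_def by blast
qed

text \<open>Reciprocal multipliers have converse graphs. This serves the surjectivity of unimodular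
  multipliers as well as both compositions of an inverse pair.\<close>

lemma mellin_multiplier_converse:
  assumes "AE t in lborel. m (Complex (1/2) t) * m' (Complex (1/2) t) = 1" and "mellin_multiplier m f g"
  shows "mellin_multiplier m' g f"
proof -
  obtain F G where "is_L2_mellin f F" "is_L2_mellin g G"
    and m: "AE t in lborel. G t = m (Complex (1/2) t) * F t"
    using assms(2) by (auto simp: mellin_multiplier_def)
  moreover have "AE t in lborel. F t = m' (Complex (1/2) t) * G t"
    using assms(1) m
  proof eventually_elim
    fix t assume inv: "m (Complex (1/2) t) * m' (Complex (1/2) t) = 1"
      and G: "G t = m (Complex (1/2) t) * F t"
    have "m' (Complex (1/2) t) * G t = (m (Complex (1/2) t) * m' (Complex (1/2) t)) * F t"
      unfolding G by (simp only: mult_ac)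
    thus "F t = m' (Complex (1/2) t) * G t" by (simp add: inv)
  qed
  ultimately show ?thesis unfolding mellin_multiplier_def by blast
qed

theorem mellin_multiplier_unitary:
  assumes [measurable]: "(\<lambda>t. m (Complex (1/2) t)) \<in> borel_measurable borel"
    and m: "AE t in lborel. cmod (m (Complex (1/2) t)) = 1"
  shows "L2_unitary half_line (mellin_multiplier m)"
  unfolding L2_unitary_def
proof (intro conjI ballI allI impI mellin_multiplier_operator)
  fix f assume "f \<in> L2 half_line"
  thus "\<exists>g. mellin_multiplier m f g" using mellin_multiplier_total[OF assms] by blast
next
  \<comment> \<open>The conjugate of a unimodular multiplier is its reciprocal, so a preimage of
    \<open>g\<close> is its image under the conjugate multiplier.\<close>
  let ?m' = "\<lambda>s. cnj (m s)"
  fix g assume "g \<in> L2 half_line"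
  moreover have "(\<lambda>t. ?m' (Complex (1/2) t)) \<in> borel_measurable borel" by measurable
  moreover have "AE t in lborel. cmod (?m' (Complex (1/2) t)) = 1" using m by simp
  ultimately obtain f where "mellin_multiplier ?m' g f"
    using mellin_multiplier_total[of ?m' g] by blast
  moreover have "AE t in lborel. ?m' (Complex (1/2) t) * m (Complex (1/2) t) = 1"
    using m by eventually_elim (simp add: complex_norm_square[symmetric] mult.commute)
  ultimately show "\<exists>f. mellin_multiplier m f g"
    using mellin_multiplier_converse[of ?m' m g] by blast
next
  fix f f' g g' assume "mellin_multiplier m f g \<and> mellin_multiplier m f' g'"
  then obtain F G F' G' where F: "is_L2_mellin f F" and G: "is_L2_mellin g G"
    and F': "is_L2_mellin f' F'" and G': "is_L2_mellin g' G'"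
    and mF: "AE t in lborel. G t = m (Complex (1/2) t) * F t" "AE t in lborel. G' t = m (Complex (1/2) t) * F' t"
    by (auto simp: mellin_multiplier_def)
  note [measurable] = F[THEN is_L2_mellin_L2(2), THEN L2_lborel_measurable]
    G[THEN is_L2_mellin_L2(2), THEN L2_lborel_measurable]
    F'[THEN is_L2_mellin_L2(2), THEN L2_lborel_measurable]
    G'[THEN is_L2_mellin_L2(2), THEN L2_lborel_measurable]
  have "L2_inner lborel G G' = L2_inner lborel F F'"
    unfolding L2_inner_def
  proof (rule integral_cong_AE)
    show "AE t in lborel. G t * cnj (G' t) = F t * cnj (F' t)"
      using mF m
    proof eventually_elim
      fix t assume *: "G t = m (Complex (1/2) t) * F t" "G' t = m (Complex (1/2) t) * F' t"
        and "cmod (m (Complex (1/2) t)) = 1"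
      hence "m (Complex (1/2) t) * cnj (m (Complex (1/2) t)) = 1"
        by (simp flip: complex_norm_square)
      moreover have "G t * cnj (G' t) = (m (Complex (1/2) t) * cnj (m (Complex (1/2) t))) * (F t * cnj (F' t))"
        by (simp add: * mult_ac)
      ultimately show "G t * cnj (G' t) = F t * cnj (F' t)" by simp
    qed
  qed measurable
  thus "L2_inner half_line g g' = L2_inner half_line f f'"
    using mellin_plancherel[OF F F'] mellin_plancherel[OF G G'] by simp
qed

text \<open>Equal norms make the integral of a difference of constant sign vanish, so the difference
  is zero almost everywhere; the strict inequality for the multiplier then forces \<open>F\<close>
  to vanish.\<close>

theorem mellin_multiplier_not_unitary:
  assumes m: "(AE t in lborel. cmod (m (Complex (1/2) t)) < 1) \<or> (AE t in lborel. cmod (m (Complex (1/2) t)) > 1)"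
  shows "\<not> L2_unitary half_line (mellin_multiplier m)"
proof
  assume U: "L2_unitary half_line (mellin_multiplier m)"
  \<comment> \<open>Any transform that is nonzero on a set of positive measure would serve.\<close>
  obtain f where f: "is_L2_mellin f (indicator {0..1})"
    using is_L2_mellin_surj[OF L2_indicator] by blast
  then obtain g where fg: "mellin_multiplier m f g"
    using U is_L2_mellin_L2(1)[OF f] unfolding L2_unitary_def by blast
  then obtain F G where F: "is_L2_mellin f F" and G: "is_L2_mellin g G"
    and mF: "AE t in lborel. G t = m (Complex (1/2) t) * F t"
    by (auto simp: mellin_multiplier_def)
  have L2: "F \<in> L2 lborel" "G \<in> L2 lborel" using F G is_L2_mellin_L2 by blast+
  have int: "integrable lborel (\<lambda>t. (cmod (F t))\<^sup>2)" "integrable lborel (\<lambda>t. (cmod (G t))\<^sup>2)"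
    using L2 by (auto simp: L2_def)
  have "L2_inner half_line g g = L2_inner half_line f f"
    using U fg unfolding L2_unitary_def by blast
  hence "L2_inner lborel G G = L2_inner lborel F F"
    by (simp add: mellin_plancherel[OF F F] mellin_plancherel[OF G G])
  hence eq: "(LINT t|lborel. (cmod (G t))\<^sup>2) = (LINT t|lborel. (cmod (F t))\<^sup>2)"
    by (simp add: L2_inner_self)
  have norm_G: "AE t in lborel. (cmod (G t))\<^sup>2 = (cmod (m (Complex (1/2) t)))\<^sup>2 * (cmod (F t))\<^sup>2"
    using mF by eventually_elim (simp add: norm_mult power_mult_distrib)
  have "AE t in lborel. F t = 0"
    using m
  proof
    assume lt: "AE t in lborel. cmod (m (Complex (1/2) t)) < 1"
    have "AE t in lborel. 0 \<le> (cmod (F t))\<^sup>2 - (cmod (G t))\<^sup>2"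
      using norm_G lt by eventually_elim (simp add: mult_left_le_one_le power_le_one)
    moreover have "(LINT t|lborel. (cmod (F t))\<^sup>2 - (cmod (G t))\<^sup>2) = 0" using eq int by simp
    ultimately have "AE t in lborel. (cmod (F t))\<^sup>2 - (cmod (G t))\<^sup>2 = 0"
      using integral_nonneg_eq_0_iff_AE[OF Bochner_Integration.integrable_diff[OF int]] by blast
    thus ?thesis
      using norm_G lt
    proof eventually_elim
      fix t assume "(cmod (F t))\<^sup>2 - (cmod (G t))\<^sup>2 = 0"
        "(cmod (G t))\<^sup>2 = (cmod (m (Complex (1/2) t)))\<^sup>2 * (cmod (F t))\<^sup>2" "cmod (m (Complex (1/2) t)) < 1"
      hence "(cmod (m (Complex (1/2) t)))\<^sup>2 < 1" "(1 - (cmod (m (Complex (1/2) t)))\<^sup>2) * (cmod (F t))\<^sup>2 = 0"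
        by (auto simp: algebra_simps abs_square_less_1)
      thus "F t = 0" by auto
    qed
  next
    assume gt: "AE t in lborel. cmod (m (Complex (1/2) t)) > 1"
    have "AE t in lborel. 0 \<le> (cmod (G t))\<^sup>2 - (cmod (F t))\<^sup>2"
      using norm_G gt
    proof eventually_elim
      fix t assume *: "(cmod (G t))\<^sup>2 = (cmod (m (Complex (1/2) t)))\<^sup>2 * (cmod (F t))\<^sup>2" "1 < cmod (m (Complex (1/2) t))"
      hence "1 * (cmod (F t))\<^sup>2 \<le> (cmod (m (Complex (1/2) t)))\<^sup>2 * (cmod (F t))\<^sup>2"
        by (intro mult_right_mono) (auto intro: one_le_power less_imp_le)
      thus "0 \<le> (cmod (G t))\<^sup>2 - (cmod (F t))\<^sup>2" by (simp add: *)
    qed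
    moreover have "(LINT t|lborel. (cmod (G t))\<^sup>2 - (cmod (F t))\<^sup>2) = 0" using eq int by simp
    ultimately have "AE t in lborel. (cmod (G t))\<^sup>2 - (cmod (F t))\<^sup>2 = 0"
      using integral_nonneg_eq_0_iff_AE[OF Bochner_Integration.integrable_diff[OF int(2,1)]] by blast
    thus ?thesis
      using norm_G gt
    proof eventually_elim
      fix t assume *: "(cmod (G t))\<^sup>2 - (cmod (F t))\<^sup>2 = 0"
        "(cmod (G t))\<^sup>2 = (cmod (m (Complex (1/2) t)))\<^sup>2 * (cmod (F t))\<^sup>2" "1 < cmod (m (Complex (1/2) t))"
      have "1 < (cmod (m (Complex (1/2) t)))\<^sup>2" using *(3) by (simp add: one_less_power)
      moreover have "((cmod (m (Complex (1/2) t)))\<^sup>2 - 1) * (cmod (F t))\<^sup>2 = 0"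
        using *(1,2) by (simp add: algebra_simps)
      ultimately show "F t = 0" by auto
    qed
  qed
  moreover have "AE t in lborel. F t = indicator {0..1} t"
    by (rule is_L2_mellin_unique[OF F f])
  ultimately have "AE t in lborel. t \<notin> {0..1::real}"
    by eventually_elim (auto simp: indicator_def split: if_splits)
  hence "emeasure lborel {0..1::real} = 0"
    by (subst (asm) AE_iff_measurable[of "{0..1}"]) auto
  thus False by simp
qed

theorem mellin_multiplier_inverse:
  assumes "(\<lambda>t. m (Complex (1/2) t)) \<in> borel_measurable borel"
    and "(\<lambda>t. m' (Complex (1/2) t)) \<in> borel_measurable borel"
    and "AE t in lborel. cmod (m (Complex (1/2) t)) = 1"
    and "AE t in lborel. m (Complex (1/2) t) * m' (Complex (1/2) t) = 1"
  shows "L2_mutually_inverse half_line (mellin_multiplier m) (mellin_multiplier m')"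
proof -
  have comp: "mellin_multiplier n OO mellin_multiplier n' = L2_eq half_line"
    if meas: "(\<lambda>t. n (Complex (1/2) t)) \<in> borel_measurable borel"
      and unimod: "AE t in lborel. cmod (n (Complex (1/2) t)) = 1"
      and inv: "AE t in lborel. n (Complex (1/2) t) * n' (Complex (1/2) t) = 1" for n n'
  proof (intro ext iffI)
    fix f h assume "(mellin_multiplier n OO mellin_multiplier n') f h"
    then obtain g where g: "mellin_multiplier n f g" "mellin_multiplier n' g h" by auto
    hence "mellin_multiplier n' g f" using mellin_multiplier_converse[OF inv] by blast
    moreover have "L2_eq half_line g g"
      using g(1) by (intro L2_eq_refl mellin_multiplier_L2)
    ultimately show "L2_eq half_line f h"
      using g(2) mellin_multiplier_operator[of n'] unfolding L2_operator_def by blast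
  next
    fix f h assume fh: "L2_eq half_line f h"
    then obtain g where g: "mellin_multiplier n f g"
      using mellin_multiplier_total[OF meas unimod] by (auto simp: L2_eq_def)
    hence "mellin_multiplier n' g f" using mellin_multiplier_converse[OF inv] by blast
    moreover have "L2_eq half_line g g"
      using g(1) by (intro L2_eq_refl mellin_multiplier_L2)
    ultimately have "mellin_multiplier n' g h"
      using fh mellin_multiplier_operator[of n'] unfolding L2_operator_def by blast
    with g show "(mellin_multiplier n OO mellin_multiplier n') f h" by auto
  qed
  \<comment> \<open>Unimodularity passes to the reciprocal, so the composition argument also applies
    with the factors exchanged.\<close>
  have "AE t in lborel. cmod (m' (Complex (1/2) t)) = 1"
    using assms(3,4)
  proof eventually_elim
    fix t assume "cmod (m (Complex (1/2) t)) = 1" "m (Complex (1/2) t) * m' (Complex (1/2) t) = 1"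
    thus "cmod (m' (Complex (1/2) t)) = 1" by (metis mult_1 norm_mult norm_one)
  qed
  thus ?thesis
    unfolding L2_mutually_inverse_def
    using comp[OF assms(1,3,4)] comp[OF assms(2), of m] assms(4)
    by (simp add: mellin_multiplier_operator mult.commute)
qed

section \<open>The multipliers on the critical line\<close>

text \<open>The reciprocal Gamma function is entire, hence continuous; inverting it with
  \<open>inverse 0 = 0\<close> also gives the totalised value at the poles.\<close>

lemma borel_measurable_Gamma [measurable]: "(Gamma :: complex \<Rightarrow> complex) \<in> borel_measurable borel"
proof -
  have [measurable]: "(rGamma :: complex \<Rightarrow> complex) \<in> borel_measurable borel"
    by (intro borel_measurable_continuous_onI continuous_intros)
  have "(\<lambda>z. inverse (rGamma z)) \<in> borel_measurable (borel :: complex measure)" by measurable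
  thus ?thesis by (simp add: Gamma_def[abs_def])
qed

lemma measurable_critical_line [measurable]: "Complex (1/2) \<in> borel_measurable borel"
  unfolding Complex_eq[abs_def] by measurable

lemma measurable_mult_S_0plus [measurable]: "mult_S_0plus \<nu> \<in> borel_measurable borel"
  unfolding mult_S_0plus_def[abs_def] by measurable

lemma measurable_mult_P_0plus [measurable]: "mult_P_0plus \<nu> \<in> borel_measurable borel"
  unfolding mult_P_0plus_def[abs_def] by measurable

text \<open>On the line \<open>Re s = 1/2\<close> conjugation is \<open>s \<mapsto> 1 - s\<close>.\<close>

lemma mult_S_minus_eq_cnj: "mult_S_minus \<nu> (Complex (1/2) t) = cnj (mult_P_0plus \<nu> (Complex (1/2) t))"
proof -
  let ?s = "Complex (1/2) t"
  have "cnj (- ?s/2 + of_real \<nu>/2 + 1) = ?s/2 + of_real \<nu>/2 + 1/2"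
    "cnj (- ?s/2 - of_real \<nu>/2 + 1/2) = ?s/2 - of_real \<nu>/2"
    "cnj (1/2 - ?s/2) = ?s/2" "cnj (1 - ?s/2) = ?s/2 + 1/2"
    by (simp_all add: complex_eq_iff)
  thus ?thesis
    by (simp only: mult_S_minus_def mult_P_0plus_def mult_S_0plus_def complex_cnj_divide complex_cnj_mult
        cnj_Gamma complex_cnj_one divide_divide_eq_right mult_1)
qed

lemma mult_P_minus_eq_cnj: "mult_P_minus \<nu> (Complex (1/2) t) = cnj (mult_S_0plus \<nu> (Complex (1/2) t))"
  by (simp add: mult_P_minus_def mult_S_minus_eq_cnj mult_P_0plus_def)

text \<open>Up to conjugation the two arguments add up to 1. A general \<open>a\<close> covers both
  parts of the multiplier: the numerator is a = nu, the denominator a = 0.\<close>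

lemma norm_Gamma_prod_critical_line:
  fixes a t :: real
  defines "s \<equiv> Complex (1/2) t"
  shows "(cmod (Gamma (- s/2 + of_real a/2 + 1) * Gamma (- s/2 - of_real a/2 + 1/2)))\<^sup>2
    = 2 * pi\<^sup>2 / (cosh (pi * t) - sin (pi * a))"
proof -
  let ?z = "- s/2 + of_real a/2 + 1"
  have "cnj (- s/2 - of_real a/2 + 1/2) = 1 - ?z"
    by (simp add: complex_eq_iff s_def)
  hence "cmod (Gamma (- s/2 - of_real a/2 + 1/2)) = cmod (Gamma (1 - ?z))"
    by (metis cnj_Gamma complex_mod_cnj)
  hence "cmod (Gamma ?z * Gamma (- s/2 - of_real a/2 + 1/2)) = cmod (Gamma ?z * Gamma (1 - ?z))"
    by (simp only: norm_mult)
  also have "\<dots> = pi / cmod (sin (of_real pi * ?z))"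
    unfolding Gamma_reflection_complex by (simp add: norm_divide)
  finally have 1: "(cmod (Gamma ?z * Gamma (- s/2 - of_real a/2 + 1/2)))\<^sup>2
      = pi\<^sup>2 / (cmod (sin (of_real pi * ?z)))\<^sup>2" by (simp add: power_divide)
  \<comment> \<open>The real part of \<open>?z\<close> is a/2 + 3/4; the shift by 3 pi/2 turns the
    cosine in |sin z|^2 = (cosh (2 Im z) - cos (2 Re z))/2 into a sine.\<close>
  have re: "2 * Re (of_real pi * ?z) = pi * a + 3/2 * pi" and im: "2 * Im (of_real pi * ?z) = - (pi * t)"
    by (simp_all add: s_def algebra_simps)
  have "cos (pi * a + 3/2 * pi) = sin (pi * a)"
    by (simp only: cos_add cos_3over2_pi sin_3over2_pi)
  hence 2: "(cmod (sin (of_real pi * ?z)))\<^sup>2 = (cosh (pi * t) - sin (pi * a)) / 2"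
    unfolding norm_sin_squared re im by (simp add: cosh_def exp_minus field_simps)
  show ?thesis unfolding 1 2 by simp
qed

text \<open>The identity includes t = 0 with sin (pi nu) = 1: a Gamma factor then sits at a pole and
  has the value 0, as does the quotient on the right.\<close>

lemma norm_mult_S_0plus:
  "(cmod (mult_S_0plus \<nu> (Complex (1/2) t)))\<^sup>2 = cosh (pi * t) / (cosh (pi * t) - sin (pi * \<nu>))"
proof -
  let ?s = "Complex (1/2) t"
  have "(cmod (Gamma (1/2 - ?s/2) * Gamma (1 - ?s/2)))\<^sup>2 = 2 * pi\<^sup>2 / cosh (pi * t)"
    using norm_Gamma_prod_critical_line[of t 0] by (simp add: mult.commute add.commute)
  thus ?thesis
    unfolding mult_S_0plus_def norm_divide power_divide norm_Gamma_prod_critical_line by simp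
qed

text \<open>For positive sine t = 0 must be excluded, because the denominator may vanish there. For
  negative sine the lower bound 0 ensures that the reciprocal multiplier exceeds 1 in modulus, which
  1/0 = 0 would not.\<close>

lemma norm_mult_S_0plus_cases:
  shows "sin (pi * \<nu>) = 0 \<Longrightarrow> cmod (mult_S_0plus \<nu> (Complex (1/2) t)) = 1"
    and "sin (pi * \<nu>) > 0 \<Longrightarrow> AE t in lborel. cmod (mult_S_0plus \<nu> (Complex (1/2) t)) > 1"
    and "sin (pi * \<nu>) < 0 \<Longrightarrow> AE t in lborel. 0 < cmod (mult_S_0plus \<nu> (Complex (1/2) t)) \<and>
      cmod (mult_S_0plus \<nu> (Complex (1/2) t)) < 1"
proof -
  let ?N = "\<lambda>t. cmod (mult_S_0plus \<nu> (Complex (1/2) t))"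
  show "?N t = 1" if "sin (pi * \<nu>) = 0" for t
    using norm_mult_S_0plus[of \<nu> t] that by (simp add: abs_square_eq_1)
  show "AE t in lborel. ?N t > 1" if s: "sin (pi * \<nu>) > 0"
    using AE_lborel_singleton[of 0]
  proof eventually_elim
    fix t :: real assume "t \<noteq> 0"
    hence "cosh (pi * t) > 1" using cosh_real_ge_1[of "pi * t"] by (simp add: less_le)
    hence "cosh (pi * t) - sin (pi * \<nu>) > 0" using sin_le_one[of "pi * \<nu>"] by linarith
    hence "1\<^sup>2 < (?N t)\<^sup>2" unfolding norm_mult_S_0plus using s by (simp add: field_simps)
    thus "?N t > 1" by (rule power2_less_imp_less) simp
  qed
  show "AE t in lborel. 0 < ?N t \<and> ?N t < 1" if s: "sin (pi * \<nu>) < 0"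
  proof (intro AE_I2 conjI)
    fix t :: real
    have "cosh (pi * t) > 0" by simp
    hence *: "cosh (pi * t) - sin (pi * \<nu>) > 0" using s by linarith
    hence "(?N t)\<^sup>2 > 0" unfolding norm_mult_S_0plus by simp
    thus "?N t > 0" by simp
    have "(?N t)\<^sup>2 < 1\<^sup>2" unfolding norm_mult_S_0plus using s * by (simp add: field_simps)
    thus "?N t < 1" by (rule power2_less_imp_less) simp
  qed
qed

theorem theorem3p1p8:
  fixes \<nu> :: real
  shows "(L2_unitary half_line (BE_S_0plus \<nu>) \<longleftrightarrow> \<nu> \<in> \<int>) \<and>
         (L2_unitary half_line (BE_P_0plus \<nu>) \<longleftrightarrow> \<nu> \<in> \<int>) \<and>
         (L2_unitary half_line (BE_P_minus \<nu>) \<longleftrightarrow> \<nu> \<in> \<int>) \<and>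
         (L2_unitary half_line (BE_S_minus \<nu>) \<longleftrightarrow> \<nu> \<in> \<int>) \<and>
         (\<nu> \<in> \<int> \<longrightarrow>
            L2_mutually_inverse half_line (BE_S_0plus \<nu>) (BE_P_minus \<nu>) \<and>
            L2_mutually_inverse half_line (BE_S_minus \<nu>) (BE_P_0plus \<nu>))"
proof (cases "\<nu> \<in> \<int>")
  case True
  hence "sin (pi * \<nu>) = 0" using sin_times_pi_eq_0[of \<nu>] by (simp add: mult.commute)
  hence S: "cmod (mult_S_0plus \<nu> (Complex (1/2) t)) = 1" for t
    by (rule norm_mult_S_0plus_cases)
  hence P: "cmod (mult_P_0plus \<nu> (Complex (1/2) t)) = 1" for t
    by (simp add: mult_P_0plus_def norm_divide)
  \<comment> \<open>For unimodular values the conjugate is the reciprocal. On the critical line the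
    multipliers within each claimed pair are conjugate to each other, hence mutually
    inverse.\<close>
  have cnj_inv: "z * cnj z = 1" "cnj z * z = 1" if "cmod z = 1" for z
    using that by (simp_all add: mult.commute flip: complex_norm_square)
  show ?thesis
    using True S P cnj_inv
    by (auto simp: BE_S_0plus_def BE_P_0plus_def BE_P_minus_def BE_S_minus_def
          mult_P_minus_eq_cnj mult_S_minus_eq_cnj
        intro!: mellin_multiplier_unitary mellin_multiplier_inverse)
next
  case False
  hence "sin (pi * \<nu>) \<noteq> 0" using sin_times_pi_eq_0[of \<nu>] by (simp add: mult.commute)
  hence S: "(AE t in lborel. cmod (mult_S_0plus \<nu> (Complex (1/2) t)) < 1) \<or>
      (AE t in lborel. cmod (mult_S_0plus \<nu> (Complex (1/2) t)) > 1)"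
    and P: "(AE t in lborel. cmod (mult_P_0plus \<nu> (Complex (1/2) t)) < 1) \<or>
      (AE t in lborel. cmod (mult_P_0plus \<nu> (Complex (1/2) t)) > 1)"
  proof -
    consider "sin (pi * \<nu>) > 0" | "sin (pi * \<nu>) < 0" using \<open>sin (pi * \<nu>) \<noteq> 0\<close> by linarith
    hence "(AE t in lborel. cmod (mult_S_0plus \<nu> (Complex (1/2) t)) > 1) \<or>
        (AE t in lborel. 0 < cmod (mult_S_0plus \<nu> (Complex (1/2) t)) \<and> cmod (mult_S_0plus \<nu> (Complex (1/2) t)) < 1)"
      using norm_mult_S_0plus_cases(2,3) by cases blast+
    thus "(AE t in lborel. cmod (mult_S_0plus \<nu> (Complex (1/2) t)) < 1) \<or>
        (AE t in lborel. cmod (mult_S_0plus \<nu> (Complex (1/2) t)) > 1)"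
      "(AE t in lborel. cmod (mult_P_0plus \<nu> (Complex (1/2) t)) < 1) \<or>
        (AE t in lborel. cmod (mult_P_0plus \<nu> (Complex (1/2) t)) > 1)"
      by (auto simp: mult_P_0plus_def norm_divide divide_less_eq_1 less_divide_eq_1 elim!: eventually_mono)
  qed
  have "\<not> L2_unitary half_line (BE_S_0plus \<nu>)" "\<not> L2_unitary half_line (BE_P_0plus \<nu>)"
    unfolding BE_S_0plus_def BE_P_0plus_def by (intro mellin_multiplier_not_unitary S P)+
  \<comment> \<open>Conjugation preserves the modulus, so the two remaining operators inherit the
    strict inequalities.\<close>
  moreover have "\<not> L2_unitary half_line (BE_P_minus \<nu>)" "\<not> L2_unitary half_line (BE_S_minus \<nu>)"
    unfolding BE_P_minus_def BE_S_minus_def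
    by (intro mellin_multiplier_not_unitary; simp add: mult_P_minus_eq_cnj mult_S_minus_eq_cnj S P)+
  ultimately show ?thesis using False by blast
qed

end
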